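(* Let $\mathbb{K}$ be a field, let $q=p^r$ be a prime power with $p$ prime, and let $\mathcal{C}$ be an $[n,k]$ code over $\mathbb{F}_q$ with parity check matrix $H\in\mathbb{F}_q^{(n-k)\times n}$. Then the generalized code ideal $I_+(\mathcal{C})\subset\mathbb{K}[\mathbf{x}]=\mathbb{K}[x_{11},\dots,x_{n,q-1}]$ satisfies $$I_+(\mathcal{C})=\left\{f(\mathbf{x},\mathbf{1})\mid f\in I_{H_+(q)}\right\},$$ where $\mathbf{1}$ is the all-one vector of length $(n-k)r$ and $I_{H_+(q)}$ is the toric ideal in $\mathbb{K}[\mathbf{x},\mathbf{y}]=\mathbb{K}[x_{11},\dots,x_{n,q-1},y_1,\dots,y_{(n-k)r}]$ associated to the integer matrix $H_+(q)$.
   Context: Codes. An $[n,k]$ code over $\mathbb{F}_q$ is a $k$-dimensional linear subspace $\mathcal{C}\subseteq\mathbb{F}_q^n$ (words are row vectors). A parity check matrix is an $(n-k)\times n$ matrix $H$ over $\mathbb{F}_q$ such that $c\in\mathcal{C}$ if and only if $cH^T=0$. Toric ideal. For an integer matrix $A$ with $N$ columns, the toric ideal of $A$ in a polynomial ring over $\mathbb{K}$ in $N$ variables $t_1,\dots,t_N$ is $I_A=\langle t^u-t^v\mid Au=Av,\ u,v\in\mathbb{N}_0^N\rangle$. Generalized code ideal. Fix a primitive element $\alpha$ of $\mathbb{F}_q$. The crossing map $\blacktriangle:\mathbb{F}_q^n\to\mathbb{Z}^{n(q-1)}$ sends $(a_1,\dots,a_n)$ to the concatenation of $n$ blocks of length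 $q-1$, where the $i$th block is the unit vector $\mathbf{e}_j$ if $a_i=\alpha^j$ with $1\le j\le q-1$, and the zero vector if $a_i=0$. The variables are $x_{ij}$, $1\le i\le n$, $1\le j\le q-1$, ordered in the same blocks. Then $I_+(\mathcal{C})=\langle\mathbf{x}^{\blacktriangle a}-\mathbf{x}^{\blacktriangle b}\mid a,b\in\mathbb{F}_q^n,\ a-b\in\mathcal{C}\rangle+I_q$, where $I_q$ is the ideal generated by $\bigcup_{i=1}^n\left(\{x_{iu}x_{iv}-x_{iw}\mid\alpha^u+\alpha^v=\alpha^w\}\cup\{x_{iu}x_{iv}-1\mid\alpha^u+\alpha^v=0\}\right)$ with $u,v,w\in\{1,\dots,q-1\}$ ($u=v$ allowed). The matrix $H_+(q)$. Fix an $\mathbb{F}_p$-basis $\{b_1,\dots,b_r\}$ of $\mathbb{F}_q$ and let $\pi_s:\mathbb{F}_q\to\mathbb{F}_p$, $\sum_j a_jb_j\mapsto a_s$, be the coordinate projections. Let $m=n-k$ and $H=(h_{ij})$. Let $H_{+,e}\in\mathbb{F}_p^{mr\times n(q-1)}$ be the matrix with rows indexed by $(i,s)$, $1\le i\le m$, $1\le s\le r$, and columns indexed by $(j,\ell)$, $1\le j\le n$, $1\le\ell\le q-1$ (both ordered lexicographically), whose entry at $((i,s),(j,\ell))$ is $\pi_s(\alpha^\ell h_{ij})$. Let $\triangle H_{+,e}$ be any integer matrix of the same size reducing to $H_{+,e}$ modulo $p$, and set $H_+(q)=\left(\triangle H_{+,e}\mid pI_{mr}\right)$ ($I_{mr}$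 being the identity matrix); its first $n(q-1)$ columns correspond to $\mathbf{x}$ and the last $mr$ columns to $\mathbf{y}$. *)

theory Defs
  imports
    "HOL-Library.Poly_Mapping"
    "HOL-Library.Cardinality"
    "HOL-Algebra.Ideal"
    "Jordan_Normal_Form.VS_Connect"
begin

section \<open>Polynomial rings, ideals, toric ideals\<close>

text \<open>
  A polynomial maps its exponents to its coefficients, and an exponent maps the indices of the
  variables to natural numbers. The variables are indexed by natural numbers; the polynomial ring
  in the variables with index less than \<open>N\<close> is a subring of the type, and ideals are ideals of
  that subring (\<open>Idl\<close> of HOL-Algebra).
\<close>

type_synonym 'k mpoly = "(nat \<Rightarrow>\<^sub>0 nat) \<Rightarrow>\<^sub>0 'k"

definition mpoly_ring :: "nat \<Rightarrow> 'k::field mpoly ring" where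
  "mpoly_ring N =
    \<lparr>carrier = {f. \<forall>m \<in> Poly_Mapping.keys f. Poly_Mapping.keys m \<subseteq> {..<N}},
     mult = (*), one = 1, zero = 0, add = (+)\<rparr>"

lemma mpoly_ring_simps:
  "f \<in> carrier (mpoly_ring N) \<longleftrightarrow> (\<forall>m \<in> Poly_Mapping.keys f. Poly_Mapping.keys m \<subseteq> {..<N})"
  "mult (mpoly_ring N) = (*)" "one (mpoly_ring N) = 1"
  "zero (mpoly_ring N) = 0" "add (mpoly_ring N) = (+)"
  by (simp_all add: mpoly_ring_def)

lemma add_closed_mp: assumes "f \<in> carrier (mpoly_ring N)" "g \<in> carrier (mpoly_ring N)"
  shows "f + g \<in> carrier (mpoly_ring N)"
  using assms keys_add[of f g] unfolding mpoly_ring_simps by blast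

lemma mult_closed_mp: assumes "f \<in> carrier (mpoly_ring N)" "g \<in> carrier (mpoly_ring N)"
  shows "f * g \<in> carrier (mpoly_ring N)"
  unfolding mpoly_ring_simps
proof
  fix m assume "m \<in> Poly_Mapping.keys (f * g)"
  with keys_mult[of f g] obtain a b where ab: "m = a + b"
        "a \<in> Poly_Mapping.keys f" "b \<in> Poly_Mapping.keys g" by blast
  with assms have "Poly_Mapping.keys a \<union> Poly_Mapping.keys b \<subseteq> {..<N}"
    unfolding mpoly_ring_simps by blast
  with keys_add[of a b] ab(1) show "Poly_Mapping.keys m \<subseteq> {..<N}" by blast
qed

text \<open>Ideals in HOL-Algebra presuppose a ring; otherwise \<open>Idl\<close> would be an empty intersection.\<close>

lemma cring_mpoly_ring: "cring (mpoly_ring N)"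
proof (rule cringI)
  show "abelian_group (mpoly_ring N :: 'a::field mpoly ring)"
  proof (rule abelian_groupI)
    fix f :: "'a mpoly" assume "f \<in> carrier (mpoly_ring N)"
    then have "- f \<in> carrier (mpoly_ring N)"
      unfolding mpoly_ring_simps in_keys_iff[of _ f] in_keys_iff[of _ "- f"] Ball_def by simp
    then show "\<exists>g\<in>carrier (mpoly_ring N). g \<oplus>\<^bsub>mpoly_ring N\<^esub> f = \<zero>\<^bsub>mpoly_ring N\<^esub>"
      unfolding mpoly_ring_simps(4-) by (intro bexI[of _ "- f"]) simp_all
  next
    show "\<zero>\<^bsub>mpoly_ring N\<^esub> \<in> carrier (mpoly_ring N :: 'a mpoly ring)"
      unfolding mpoly_ring_simps by simp
  qed (unfold mpoly_ring_simps(4-), simp_all only: add_closed_mp ac_simps add_0_left add_0_right)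
  show "Group.comm_monoid (mpoly_ring N :: 'a mpoly ring)"
  proof (rule comm_monoidI)
    show "\<one>\<^bsub>mpoly_ring N\<^esub> \<in> carrier (mpoly_ring N :: 'a mpoly ring)"
      unfolding mpoly_ring_simps by simp
  qed (unfold mpoly_ring_simps(2-3), simp_all only: mult_closed_mp ac_simps mult_1_left mult_1_right)
qed (unfold mpoly_ring_simps(2,5), rule distrib_right)

definition Var :: "nat \<Rightarrow> 'k::field mpoly" where
  "Var i = Poly_Mapping.single (Poly_Mapping.single i 1) 1"

definition monomial :: "nat vec \<Rightarrow> 'k::field mpoly" where
  "monomial u = (\<Prod>i<dim_vec u. Var i ^ (u $ i))"

definition subst :: "(nat \<Rightarrow> 'k mpoly) \<Rightarrow> 'k::field mpoly \<Rightarrow> 'k mpoly" where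
  "subst \<sigma> f = (\<Sum>m\<in>Poly_Mapping.keys f.
     Poly_Mapping.single 0 (Poly_Mapping.lookup f m) *
       (\<Prod>i\<in>Poly_Mapping.keys m. \<sigma> i ^ Poly_Mapping.lookup m i))"

definition toric_ideal :: "int mat \<Rightarrow> 'k::field mpoly set" where
  "toric_ideal A = Idl\<^bsub>mpoly_ring (dim_col A)\<^esub>
     {monomial u - monomial v | u v.
        u \<in> carrier_vec (dim_col A) \<and> v \<in> carrier_vec (dim_col A) \<and>
        A *\<^sub>v map_vec int u = A *\<^sub>v map_vec int v}"

section \<open>Codes and the generalized code ideal\<close>

text \<open>The field with \<open>q\<close> elements is a type \<open>'f\<close>, and \<open>q = CARD('f)\<close>.\<close>

definition linear_code :: "nat \<Rightarrow> nat \<Rightarrow> 'f::field vec set \<Rightarrow> bool" where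
  "linear_code n k C \<longleftrightarrow>
     VectorSpace.subspace class_ring C (module_vec TYPE('f) n) \<and>
     vectorspace.dim class_ring ((module_vec TYPE('f) n)\<lparr>carrier := C\<rparr>) = k"

text \<open>The condition \<open>c H\<^sup>T = 0\<close> on row vectors is \<open>H c = 0\<close> on the vectors of the library.\<close>

definition parity_check_matrix :: "nat \<Rightarrow> nat \<Rightarrow> 'f::field vec set \<Rightarrow> 'f mat \<Rightarrow> bool" where
  "parity_check_matrix n k C H \<longleftrightarrow>
     H \<in> carrier_mat (n - k) n \<and>
     (\<forall>c \<in> carrier_vec n. c \<in> C \<longleftrightarrow> H *\<^sub>v c = 0\<^sub>v (n - k))"

definition primitive_element :: "'f::field \<Rightarrow> bool" where
  "primitive_element \<alpha> \<longleftrightarrow> {\<alpha> ^ j | j::nat. True} = UNIV - {0}"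

text \<open>
  Positions in a word, rows and columns are numbered from 0, whereas the exponents of \<open>\<alpha>\<close> run
  through \<open>1, \<dots>, q - 1\<close>. Hence position \<open>t\<close> in a sequence of blocks of length \<open>q - 1\<close> belongs to
  block \<open>t div (q - 1)\<close> and to the exponent \<open>t mod (q - 1) + 1\<close>.
\<close>

definition crossing :: "'f::{finite,field} \<Rightarrow> 'f vec \<Rightarrow> nat vec" where
  "crossing \<alpha> a = vec (dim_vec a * (CARD('f) - 1))
     (\<lambda>t. if a $ (t div (CARD('f) - 1)) = \<alpha> ^ (t mod (CARD('f) - 1) + 1) then 1 else 0)"

text \<open>The variable \<open>x\<^sub>i\<^sub>j\<close> with \<open>i < n\<close> and \<open>1 \<le> j \<le> q - 1\<close>.\<close>

definition xvar :: "nat \<Rightarrow> nat \<Rightarrow> nat \<Rightarrow> 'k::field mpoly" where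
  "xvar q i j = Var (i * (q - 1) + (j - 1))"

definition I_q :: "'f::{finite,field} \<Rightarrow> nat \<Rightarrow> 'k::field mpoly set" where
  "I_q \<alpha> n = Idl\<^bsub>mpoly_ring (n * (CARD('f) - 1))\<^esub>
     (\<Union>i<n.
       {xvar CARD('f) i u * xvar CARD('f) i v - xvar CARD('f) i w | u v w.
          u \<in> {1..CARD('f) - 1} \<and> v \<in> {1..CARD('f) - 1} \<and> w \<in> {1..CARD('f) - 1} \<and>
          \<alpha> ^ u + \<alpha> ^ v = \<alpha> ^ w} \<union>
       {xvar CARD('f) i u * xvar CARD('f) i v - 1 | u v.
          u \<in> {1..CARD('f) - 1} \<and> v \<in> {1..CARD('f) - 1} \<and> \<alpha> ^ u + \<alpha> ^ v = 0})"

definition code_ideal :: "'f::{finite,field} \<Rightarrow> nat \<Rightarrow> 'f vec set \<Rightarrow> 'k::field mpoly set" where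
  "code_ideal \<alpha> n C =
     Idl\<^bsub>mpoly_ring (n * (CARD('f) - 1))\<^esub>
       {monomial (crossing \<alpha> a) - monomial (crossing \<alpha> b) | a b.
          a \<in> carrier_vec n \<and> b \<in> carrier_vec n \<and> a - b \<in> C}
     <+>\<^bsub>mpoly_ring (n * (CARD('f) - 1))\<^esub> I_q \<alpha> n"

section \<open>The matrix $H_+(q)$\<close>

text \<open>
  The field with \<open>p\<close> elements is the prime subfield of \<open>'f\<close>, so that reduction modulo \<open>p\<close> is
  \<open>of_int :: int \<Rightarrow> 'f\<close>.
\<close>

definition prime_subfield :: "'f::field ring" where
  "prime_subfield = class_ring\<lparr>carrier := range of_int\<rparr>"

definition field_as_space :: "('f::field, 'f) module" where
  "field_as_space =
    \<lparr>carrier = UNIV, mult = (*), one = 1, zero = 0, add = (+), smult = (*)\<rparr>"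

definition prime_basis :: "nat \<Rightarrow> (nat \<Rightarrow> 'f::field) \<Rightarrow> bool" where
  "prime_basis r b \<longleftrightarrow>
     inj_on b {..<r} \<and> vectorspace.basis prime_subfield field_as_space (b ` {..<r})"

definition coord :: "nat \<Rightarrow> (nat \<Rightarrow> 'f::field) \<Rightarrow> nat \<Rightarrow> 'f \<Rightarrow> 'f" where
  "coord r b s x = (THE c. \<exists>a. (\<forall>j<r. a j \<in> range of_int) \<and>
     x = (\<Sum>j<r. a j * b j) \<and> c = a s)"

definition H_plus_e ::
  "'f::{finite,field} \<Rightarrow> nat \<Rightarrow> (nat \<Rightarrow> 'f) \<Rightarrow> 'f mat \<Rightarrow> 'f mat" where
  "H_plus_e \<alpha> r b H = mat (dim_row H * r) (dim_col H * (CARD('f) - 1))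
     (\<lambda>(i, j). coord r b (i mod r)
        (\<alpha> ^ (j mod (CARD('f) - 1) + 1) * H $$ (i div r, j div (CARD('f) - 1))))"

text \<open>The block matrix \<open>(D | p I)\<close>; the two lower blocks have no rows.\<close>

definition H_plus :: "nat \<Rightarrow> int mat \<Rightarrow> int mat" where
  "H_plus p D = four_block_mat D (int p \<cdot>\<^sub>m 1\<^sub>m (dim_row D))
     (0\<^sub>m 0 (dim_col D)) (0\<^sub>m 0 (dim_row D))"

text \<open>The substitution \<open>f(x, 1)\<close>, where the first \<open>N\<close> variables are the \<open>x\<close>.\<close>

definition set_y_one :: "nat \<Rightarrow> 'k::field mpoly \<Rightarrow> 'k mpoly" where
  "set_y_one N = subst (\<lambda>i. if i < N then Var i else 1)"

end

theory Submission
  imports Defs "HOL-Algebra.QuotRing" "HOL-Number_Theory.Residues"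
begin

text \<open>
  Both sides turn out to be the ideal generated by all differences \<open>x\<^sup>u - x\<^sup>v\<close> of monomials for
  which \<open>\<phi> u - \<phi> v\<close> is a codeword. Here \<open>\<phi>\<close> (\<open>word_of\<close>) sends an exponent vector \<open>u\<close> to the word
  whose \<open>i\<close>th letter is \<open>\<Sum>\<^sub>j u\<^sub>i\<^sub>j \<alpha>\<^sup>j\<close>; it is additive and the crossing map is a section of it.

  For the code ideal, the generators of \<open>I_q\<close> say precisely that \<open>\<alpha>\<^sup>j \<mapsto> x\<^sub>i\<^sub>j\<close>, \<open>0 \<mapsto> 1\<close> turns
  addition in the field into multiplication modulo \<open>I_q\<close>. Hence every monomial \<open>x\<^sup>u\<close> is congruent
  to the monomial of the crossing of \<open>\<phi> u\<close> (\<open>monomial_reduces_to_crossing\<close>), and a difference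
  \<open>x\<^sup>u - x\<^sup>v\<close> can be moved to a difference of crossings. Conversely the two
  monomials in a generator of \<open>I_q\<close> have the same image under \<open>\<phi>\<close>, and the zero word is a codeword.
  The result is \<open>code_ideal_eq_congruence_ideal\<close>.

  For the toric ideal, \<open>y \<mapsto> 1\<close> is a surjective ring homomorphism, so it sends the ideal generated
  by a set to the ideal generated by the image of the set (\<open>surj_image_Idl\<close>). Therefore only the
  exponents matter: \<open>x\<^sup>u - x\<^sup>v\<close> is the image of a toric generator if and only if suitable
  exponents of the \<open>y\<close> make up for the difference of \<open>D u\<close> and \<open>D v\<close>, that is, if and only if
  \<open>D u\<close> and \<open>D v\<close> agree modulo \<open>p\<close>. Modulo \<open>p\<close>, the entries of \<open>D u\<close> are the coordinates over
  the prime subfield of the entries of the syndrome \<open>H (\<phi> u)\<close> (\<open>of_int_lift_mult\<close>), and an element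
  of the field is determined by its coordinates. So the condition is \<open>H (\<phi> u) = H (\<phi> v)\<close>, or
  equivalently \<open>\<phi> u - \<phi> v \<in> C\<close> (\<open>same_fibre_iff_diff_in_code\<close>).
\<close>

section \<open>Substitution is a ring homomorphism\<close>

lemma sum_single_lookup:
  fixes f :: "'a \<Rightarrow>\<^sub>0 'b::comm_monoid_add"
  shows "(\<Sum>m\<in>Poly_Mapping.keys f. Poly_Mapping.single m (Poly_Mapping.lookup f m)) = f"
  by (rule poly_mapping_eqI)
    (auto simp: lookup_sum lookup_single when_def in_keys_iff sum.delta)

definition subst_monomial :: "(nat \<Rightarrow> 'k mpoly) \<Rightarrow> (nat \<Rightarrow>\<^sub>0 nat) \<Rightarrow> 'k::field mpoly" where
  "subst_monomial \<sigma> m = (\<Prod>i\<in>Poly_Mapping.keys m. \<sigma> i ^ Poly_Mapping.lookup m i)"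

lemma subst_monomial_superset:
  assumes "finite S" "Poly_Mapping.keys m \<subseteq> S"
  shows "subst_monomial \<sigma> m = (\<Prod>i\<in>S. \<sigma> i ^ Poly_Mapping.lookup m i)"
  unfolding subst_monomial_def using assms
  by (intro prod.mono_neutral_left) (auto simp: in_keys_iff)

lemma subst_monomial_add:
  "subst_monomial \<sigma> (m + m') = subst_monomial \<sigma> m * subst_monomial \<sigma> m'"
proof -
  define S where "S = Poly_Mapping.keys m \<union> Poly_Mapping.keys m'"
  have "finite S" "Poly_Mapping.keys m \<subseteq> S" "Poly_Mapping.keys m' \<subseteq> S"
    "Poly_Mapping.keys (m + m') \<subseteq> S"
    using keys_add[of m m'] by (auto simp: S_def)
  then show ?thesis
    by (simp add: subst_monomial_superset[of S] lookup_add power_add prod.distrib)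
qed

text \<open>
  The definition of \<open>subst\<close> sums over the exponents that occur in the polynomial. Two polynomials
  can be compared only after both sums have been extended to a common index set.
\<close>

lemma subst_superset:
  assumes "finite S" "Poly_Mapping.keys f \<subseteq> S"
  shows "subst \<sigma> f =
    (\<Sum>m\<in>S. Poly_Mapping.single 0 (Poly_Mapping.lookup f m) * subst_monomial \<sigma> m)"
  unfolding subst_def subst_monomial_def[symmetric] using assms
  by (intro sum.mono_neutral_left) (auto simp: in_keys_iff)

lemma subst_add: "subst \<sigma> (f + g) = subst \<sigma> f + subst \<sigma> g"
proof -
  define S where "S = Poly_Mapping.keys f \<union> Poly_Mapping.keys g"
  have "finite S" "Poly_Mapping.keys f \<subseteq> S" "Poly_Mapping.keys g \<subseteq> S"
    "Poly_Mapping.keys (f + g) \<subseteq> S"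
    using keys_add[of f g] by (auto simp: S_def)
  then show ?thesis
    by (simp add: subst_superset[of S] lookup_add single_add distrib_right sum.distrib)
qed

lemma subst_zero [simp]: "subst \<sigma> 0 = 0"
  by (simp add: subst_def)

lemma subst_single:
  "subst \<sigma> (Poly_Mapping.single m c) = Poly_Mapping.single 0 c * subst_monomial \<sigma> m"
  by (simp add: subst_superset[of "{m}"])

lemma subst_one [simp]: "subst \<sigma> 1 = 1"
  using subst_single[of \<sigma> 0 1] by (simp add: subst_monomial_def)

lemma subst_Var [simp]: "subst \<sigma> (Var i) = \<sigma> i"
  by (simp add: Var_def subst_single subst_monomial_superset[of "{i}"])

lemma subst_sum: "subst \<sigma> (\<Sum>i\<in>A. f i) = (\<Sum>i\<in>A. subst \<sigma> (f i))"
  by (induction A rule: infinite_finite_induct) (simp_all add: subst_add)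

text \<open>
  Both sides are biadditive, and every polynomial is a sum of terms; for two terms the identity
  is \<open>subst_monomial_add\<close>.
\<close>

lemma subst_mult: "subst \<sigma> (f * g) = subst \<sigma> f * subst \<sigma> g"
proof -
  have single: "subst \<sigma> (Poly_Mapping.single m c * Poly_Mapping.single m' c') =
      subst \<sigma> (Poly_Mapping.single m c) * subst \<sigma> (Poly_Mapping.single m' c')" for m m' c c'
  proof -
    have "Poly_Mapping.single 0 (c * c') =
        (Poly_Mapping.single 0 c * Poly_Mapping.single 0 c' :: 'a mpoly)"
      by (simp add: mult_single)
    then show ?thesis
      by (simp add: mult_single subst_single subst_monomial_add ac_simps)
  qed
  let ?t = "\<lambda>h m. Poly_Mapping.single m (Poly_Mapping.lookup h m)"
  have "subst \<sigma> (f * g) =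
      subst \<sigma> ((\<Sum>m\<in>Poly_Mapping.keys f. ?t f m) * (\<Sum>m\<in>Poly_Mapping.keys g. ?t g m))"
    by (simp add: sum_single_lookup)
  also have "\<dots> = subst \<sigma> (\<Sum>m\<in>Poly_Mapping.keys f. ?t f m) *
      subst \<sigma> (\<Sum>m\<in>Poly_Mapping.keys g. ?t g m)"
    by (simp only: sum_product subst_sum single)
  finally show ?thesis by (simp add: sum_single_lookup)
qed

lemma subst_power: "subst \<sigma> (f ^ e) = subst \<sigma> f ^ e"
  by (induction e) (simp_all add: subst_mult)

lemma subst_prod: "subst \<sigma> (\<Prod>i\<in>A. f i) = (\<Prod>i\<in>A. subst \<sigma> (f i))"
  by (induction A rule: infinite_finite_induct) (simp_all add: subst_mult)

lemma subst_minus: "subst \<sigma> (f - g) = subst \<sigma> f - subst \<sigma> g"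
  using subst_add[of \<sigma> "f - g" g] by simp

lemma Var_power: "Var i ^ e = Poly_Mapping.single (Poly_Mapping.single i e) 1"
  by (induction e) (simp_all add: Var_def mult_single flip: single_add)

lemma prod_single:
  "(\<Prod>i\<in>A. Poly_Mapping.single (e i) 1) =
    (Poly_Mapping.single (\<Sum>i\<in>A. e i) 1 :: 'k::field mpoly)"
  by (induction A rule: infinite_finite_induct) (simp_all add: mult_single)

lemma subst_id_on_variables:
  assumes "f \<in> carrier (mpoly_ring N)" "\<And>i. i < N \<Longrightarrow> \<sigma> i = Var i"
  shows "subst \<sigma> f = f"
proof -
  have "subst_monomial \<sigma> m = Poly_Mapping.single m 1" if "m \<in> Poly_Mapping.keys f" for m
  proof -
    have "subst_monomial \<sigma> m = (\<Prod>i\<in>Poly_Mapping.keys m. Var i ^ Poly_Mapping.lookup m i)"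
      unfolding subst_monomial_def
    proof (rule prod.cong)
      fix i assume "i \<in> Poly_Mapping.keys m"
      then have "i < N" using assms(1) that by (auto simp: mpoly_ring_simps)
      then show "\<sigma> i ^ Poly_Mapping.lookup m i = Var i ^ Poly_Mapping.lookup m i"
        by (simp add: assms(2))
    qed simp
    then show ?thesis by (simp add: Var_power prod_single sum_single_lookup)
  qed
  then have "subst \<sigma> f = (\<Sum>m\<in>Poly_Mapping.keys f. Poly_Mapping.single m (Poly_Mapping.lookup f m))"
    unfolding subst_superset[OF finite_keys order.refl] by (intro sum.cong) (simp_all add: mult_single)
  then show ?thesis by (simp add: sum_single_lookup)
qed

section \<open>The homomorphism that sets the last variables to one\<close>

lemma zero_closed_mp: "0 \<in> carrier (mpoly_ring N)"
  and one_closed_mp: "1 \<in> carrier (mpoly_ring N)"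
  and const_closed_mp: "Poly_Mapping.single 0 c \<in> carrier (mpoly_ring N)"
  and Var_closed_mp: "i < N \<Longrightarrow> Var i \<in> carrier (mpoly_ring N)"
  by (auto simp: mpoly_ring_simps Var_def)

lemma uminus_closed_mp: "f \<in> carrier (mpoly_ring N) \<Longrightarrow> - f \<in> carrier (mpoly_ring N)"
  by (simp add: mpoly_ring_simps)

lemma minus_closed_mp:
  "f \<in> carrier (mpoly_ring N) \<Longrightarrow> g \<in> carrier (mpoly_ring N) \<Longrightarrow> f - g \<in> carrier (mpoly_ring N)"
  using add_closed_mp[of f N "- g"] uminus_closed_mp[of g N] by simp

lemma power_closed_mp: "f \<in> carrier (mpoly_ring N) \<Longrightarrow> f ^ e \<in> carrier (mpoly_ring N)"
  by (induction e) (simp_all add: one_closed_mp mult_closed_mp)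

lemma prod_closed_mp:
  "(\<And>i. i \<in> A \<Longrightarrow> f i \<in> carrier (mpoly_ring N)) \<Longrightarrow> (\<Prod>i\<in>A. f i) \<in> carrier (mpoly_ring N)"
  by (induction A rule: infinite_finite_induct) (simp_all add: one_closed_mp mult_closed_mp)

lemma sum_closed_mp:
  "(\<And>i. i \<in> A \<Longrightarrow> f i \<in> carrier (mpoly_ring N)) \<Longrightarrow> (\<Sum>i\<in>A. f i) \<in> carrier (mpoly_ring N)"
  by (induction A rule: infinite_finite_induct) (simp_all add: zero_closed_mp add_closed_mp)

lemma monomial_closed: "u \<in> carrier_vec N \<Longrightarrow> monomial u \<in> carrier (mpoly_ring N)"
  by (auto simp: monomial_def intro!: prod_closed_mp power_closed_mp Var_closed_mp)

lemma monomial_zero: "monomial (0\<^sub>v N) = 1"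
  by (simp add: monomial_def)

lemma monomial_add:
  "u \<in> carrier_vec N \<Longrightarrow> v \<in> carrier_vec N \<Longrightarrow> monomial (u + v) = monomial u * monomial v"
  by (simp add: monomial_def power_add prod.distrib carrier_vecD)

lemma monomial_unit_vec:
  assumes "t < N"
  shows "monomial (unit_vec N t) = Var t"
proof -
  have "monomial (unit_vec N t) = (\<Prod>i<N. if i = t then Var t else 1)"
    unfolding monomial_def using assms by (intro prod.cong) auto
  then show ?thesis using assms by simp
qed

lemma set_y_one_closed: "set_y_one N f \<in> carrier (mpoly_ring N)"
  unfolding set_y_one_def subst_def
  by (auto intro!: sum_closed_mp mult_closed_mp const_closed_mp prod_closed_mp power_closed_mp
      Var_closed_mp one_closed_mp)

lemma ring_hom_set_y_one:
  "ring_hom_ring (mpoly_ring (N + M)) (mpoly_ring N) (set_y_one N :: 'k::field mpoly \<Rightarrow> _)"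
proof (rule ring_hom_ringI)
  show "Ring.ring (mpoly_ring (N + M) :: 'k mpoly ring)" "Ring.ring (mpoly_ring N :: 'k mpoly ring)"
    using cring_mpoly_ring cring.axioms(1) by blast+
qed (simp_all only: mpoly_ring_simps(2-) set_y_one_closed, simp_all add: set_y_one_def subst_add subst_mult)

lemma set_y_one_minus: "set_y_one N (f - g) = set_y_one N f - set_y_one N g"
  by (simp add: set_y_one_def subst_minus)

lemma set_y_one_surj:
  "set_y_one N ` carrier (mpoly_ring (N + M)) = (carrier (mpoly_ring N) :: 'k::field mpoly set)"
proof (intro equalityI subsetI)
  fix f :: "'k mpoly" assume f: "f \<in> carrier (mpoly_ring N)"
  then have "f \<in> carrier (mpoly_ring (N + M))"
    by (fastforce simp: mpoly_ring_simps)
  moreover have "set_y_one N f = f"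
    unfolding set_y_one_def using f by (rule subst_id_on_variables) simp
  ultimately show "f \<in> set_y_one N ` carrier (mpoly_ring (N + M))" by (metis image_eqI)
qed (auto simp: set_y_one_closed)

lemma set_y_one_monomial_append:
  assumes "u \<in> carrier_vec N"
  shows "set_y_one N (monomial (u @\<^sub>v y)) = monomial u"
proof -
  have "set_y_one N (monomial (u @\<^sub>v y)) =
      (\<Prod>i<N + dim_vec y. (if i < N then Var i else 1) ^ ((u @\<^sub>v y) $ i))"
    using assms by (simp add: set_y_one_def monomial_def subst_prod subst_power)
  also have "\<dots> = (\<Prod>i<N. (if i < N then Var i else 1) ^ ((u @\<^sub>v y) $ i))"
    by (intro prod.mono_neutral_right) auto
  also have "\<dots> = monomial u"
    using assms unfolding monomial_def by (intro prod.cong) auto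
  finally show ?thesis .
qed

section \<open>Generated ideals and congruence modulo an ideal\<close>

text \<open>
  Surjectivity makes the image of an ideal an ideal again. Together with the fact that preimages
  of ideals are ideals, this gives the two inclusions by minimality.
\<close>

lemma (in ring_hom_ring) surj_image_Idl:
  assumes surj: "h ` carrier R = carrier S" and G: "G \<subseteq> carrier R"
  shows "h ` (Idl\<^bsub>R\<^esub> G) = Idl\<^bsub>S\<^esub> (h ` G)"
proof
  have hG: "h ` G \<subseteq> carrier S" using G surj by blast
  have "ideal {r \<in> carrier R. h r \<in> Idl\<^bsub>S\<^esub> (h ` G)} R"
    by (rule ideal_vimage[OF S.genideal_ideal[OF hG]])
  then have "Idl\<^bsub>R\<^esub> G \<subseteq> {r \<in> carrier R. h r \<in> Idl\<^bsub>S\<^esub> (h ` G)}"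
    using G S.genideal_self[OF hG] by (intro R.genideal_minimal) auto
  then show "h ` (Idl\<^bsub>R\<^esub> G) \<subseteq> Idl\<^bsub>S\<^esub> (h ` G)" by blast
next
  interpret I: ideal "Idl\<^bsub>R\<^esub> G" R by (rule R.genideal_ideal[OF G])
  have "ideal (h ` (Idl\<^bsub>R\<^esub> G)) S"
  proof (rule idealI)
    show "subgroup (h ` (Idl\<^bsub>R\<^esub> G)) (add_monoid S)"
      using group_hom.subgroup_img_is_subgroup[OF a_group_hom I.a_subgroup] .
  next
    fix a x assume "a \<in> h ` (Idl\<^bsub>R\<^esub> G)" "x \<in> carrier S"
    then obtain b y where ax: "b \<in> Idl\<^bsub>R\<^esub> G" "a = h b" "y \<in> carrier R" "x = h y"
      using surj by blast
    moreover have "x \<otimes>\<^bsub>S\<^esub> a = h (y \<otimes> b)" "a \<otimes>\<^bsub>S\<^esub> x = h (b \<otimes> y)"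
      using ax I.Icarr by simp_all
    ultimately show "x \<otimes>\<^bsub>S\<^esub> a \<in> h ` (Idl\<^bsub>R\<^esub> G)" "a \<otimes>\<^bsub>S\<^esub> x \<in> h ` (Idl\<^bsub>R\<^esub> G)"
      using ax I.I_l_closed I.I_r_closed by (simp_all only: image_eqI)
  qed (rule S.ring_axioms)
  then show "Idl\<^bsub>S\<^esub> (h ` G) \<subseteq> h ` (Idl\<^bsub>R\<^esub> G)"
    using R.genideal_self[OF G] by (intro S.genideal_minimal image_mono)
qed

lemma ring_mpoly_ring: "Ring.ring (mpoly_ring N)"
  using cring_mpoly_ring by (rule cring.axioms(1))

text \<open>
  The closure properties of ideals in terms of the operations of the polynomial type, on which
  the simplifier can compute. Congruence of \<open>f\<close> and \<open>g\<close> modulo \<open>I\<close> is written as \<open>f - g \<in> I\<close>.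
\<close>

lemma
  assumes "ideal I (mpoly_ring N)"
  shows ideal_mp_zero: "0 \<in> I"
    and ideal_mp_add: "f \<in> I \<Longrightarrow> g \<in> I \<Longrightarrow> f + g \<in> I"
    and ideal_mp_mult: "f \<in> I \<Longrightarrow> h \<in> carrier (mpoly_ring N) \<Longrightarrow> h * f \<in> I"
proof -
  interpret I: ideal I "mpoly_ring N" by (rule assms)
  show "0 \<in> I" using additive_subgroup.zero_closed[OF I.is_additive_subgroup] by (simp only: mpoly_ring_simps(4))
  show "f \<in> I \<Longrightarrow> g \<in> I \<Longrightarrow> f + g \<in> I" using additive_subgroup.a_closed[OF I.is_additive_subgroup] by (simp only: mpoly_ring_simps(5))
  show "f \<in> I \<Longrightarrow> h \<in> carrier (mpoly_ring N) \<Longrightarrow> h * f \<in> I"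
    using I.I_l_closed by (simp only: mpoly_ring_simps(2))
qed

lemma ideal_mp_minus:
  assumes "ideal I (mpoly_ring N)" "f \<in> I" "g \<in> I"
  shows "f - g \<in> I"
  using ideal_mp_add[OF assms(1,2) ideal_mp_mult[OF assms(1,3) uminus_closed_mp[OF one_closed_mp]]]
  by simp

lemma ideal_diff_mult:
  assumes I: "ideal I (mpoly_ring N)" and "f - f' \<in> I" "g - g' \<in> I"
    and "g \<in> carrier (mpoly_ring N)" "f' \<in> carrier (mpoly_ring N)"
  shows "f * g - f' * g' \<in> I"
proof -
  have "g * (f - f') + f' * (g - g') \<in> I"
    using assms by (intro ideal_mp_add[OF I] ideal_mp_mult[OF I])
  then show ?thesis by (simp add: algebra_simps)
qed

lemma ideal_diff_prod:
  assumes I: "ideal I (mpoly_ring N)" and "\<And>i. i \<in> A \<Longrightarrow> f i - g i \<in> I"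
    and "\<And>i. i \<in> A \<Longrightarrow> f i \<in> carrier (mpoly_ring N)"
    and "\<And>i. i \<in> A \<Longrightarrow> g i \<in> carrier (mpoly_ring N)"
  shows "(\<Prod>i\<in>A. f i) - (\<Prod>i\<in>A. g i) \<in> I"
  using assms(2-)
proof (induction A rule: infinite_finite_induct)
  case (insert x A)
  then show ?case
    by (simp, intro ideal_diff_mult[OF I]) (auto intro: prod_closed_mp)
qed (simp_all add: ideal_mp_zero[OF I])

lemma ideal_diff_trans:
  assumes I: "ideal I (mpoly_ring N)" and "f - g \<in> I" "g - h \<in> I"
  shows "f - h \<in> I"
  using ideal_mp_add[OF assms] by simp

section \<open>Powers of a primitive element\<close>

(* The block length CARD('f) - 1 occurs throughout; this rule would turn it into CARD('f) - Suc 0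
   in goals but not in the facts that are to be rewritten with. *)
declare One_nat_def [simp del]

text \<open>
  Multiplication by \<open>x\<close> permutes the nonzero elements, so their product does not change when each
  of them is multiplied by \<open>x\<close>.
\<close>

lemma power_card_minus_one:
  fixes x :: "'f::{finite,field}"
  assumes "x \<noteq> 0"
  shows "x ^ (CARD('f) - 1) = 1"
proof -
  have "(\<Prod>y\<in>UNIV - {0}. y) = (\<Prod>y\<in>UNIV - {0}. x * y)"
    by (rule prod.reindex_bij_witness[of _ "\<lambda>y. x * y" "\<lambda>y. y / x"]) (use assms in auto)
  also have "\<dots> = x ^ (CARD('f) - 1) * (\<Prod>y\<in>UNIV - {0}. y)"
    by (simp add: prod.distrib card_Diff_subset One_nat_def)
  finally show ?thesis by simp
qed

text \<open>
  By \<open>power_card_minus_one\<close> every exponent can be reduced to the range \<open>1, \<dots>, q - 1\<close>, so these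
  powers exhaust the nonzero elements. There are \<open>q - 1\<close> of both, which forces injectivity.
\<close>

lemma bij_betw_primitive_powers:
  fixes \<alpha> :: "'f::{finite,field}"
  assumes "primitive_element \<alpha>"
  shows "bij_betw (\<lambda>j. \<alpha> ^ j) {1..CARD('f) - 1} (UNIV - {0})"
proof -
  let ?Q = "CARD('f) - 1"
  have nz: "\<alpha> \<noteq> 0"
  proof -
    have "\<alpha> ^ 1 \<in> UNIV - {0}" using assms unfolding primitive_element_def by blast
    then show ?thesis by simp
  qed
  have "card {0::'f, 1} \<le> CARD('f)" by (rule card_mono) auto
  then have Q: "?Q > 0" by simp
  have "x \<in> (\<lambda>j. \<alpha> ^ j) ` {1..?Q}" if x: "x \<noteq> 0" for x
  proof -
    obtain j where j: "x = \<alpha> ^ j"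
      using assms x unfolding primitive_element_def by blast
    have "\<alpha> ^ (?Q * (j div ?Q) + j mod ?Q) = \<alpha> ^ (j mod ?Q)"
      by (simp only: power_add power_mult power_card_minus_one[OF nz] power_one mult_1_left)
    then have xj: "x = \<alpha> ^ (j mod ?Q)" using j by simp
    show ?thesis
    proof (cases "j mod ?Q = 0")
      case True
      then have "x = \<alpha> ^ ?Q" using xj power_card_minus_one[OF nz] by simp
      then show ?thesis using Q by (intro image_eqI[of _ _ ?Q]) auto
    next
      case False
      moreover have "j mod ?Q < ?Q" using Q by simp
      ultimately show ?thesis using xj by (intro image_eqI[of _ _ "j mod ?Q"]) auto
    qed
  qed
  then have im: "(\<lambda>j. \<alpha> ^ j) ` {1..?Q} = UNIV - {0}" using nz by auto
  have "inj_on (\<lambda>j. \<alpha> ^ j) {1..?Q}"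
    by (rule eq_card_imp_inj_on) (simp_all only: im finite_atLeastAtMost, simp add: card_Diff_subset)
  then show ?thesis using im by (simp add: bij_betw_def)
qed

lemma primitive_power_eq_iff:
  fixes \<alpha> :: "'f::{finite,field}"
  assumes "primitive_element \<alpha>" "i < CARD('f) - 1" "j < CARD('f) - 1"
  shows "\<alpha> ^ (i + 1) = \<alpha> ^ (j + 1) \<longleftrightarrow> i = j"
  using bij_betw_imp_inj_on[OF bij_betw_primitive_powers[OF assms(1)]] assms(2,3)
  by (auto dest!: inj_onD[where x = "i + 1" and y = "j + 1"])

lemma primitive_power_cases:
  fixes \<alpha> :: "'f::{finite,field}"
  assumes "primitive_element \<alpha>" "c \<noteq> 0"
  obtains j where "j < CARD('f) - 1" "c = \<alpha> ^ (j + 1)"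
proof -
  obtain j where "j \<in> {1..CARD('f) - 1}" "c = \<alpha> ^ j"
    using bij_betw_imp_surj_on[OF bij_betw_primitive_powers[OF assms(1)]] assms(2) by blast
  then show ?thesis by (intro that[of "j - 1"]) auto
qed

section \<open>The word of an exponent vector\<close>

lemma (in comm_monoid_set) blocks:
  fixes k :: nat
  shows "F g {..<n * k} = F (\<lambda>i. F (\<lambda>j. g (i * k + j)) {..<k}) {..<n}"
  unfolding nat_group[symmetric]
  by (rule cong) (simp_all add: atLeastLessThan_shift_0[of _ "_ * k"] lessThan_atLeast0)

lemma block_index_less:
  fixes i j k n :: nat
  assumes "i < n" "j < k"
  shows "i * k + j < n * k"
proof -
  have "i * k + j < (i + 1) * k" using assms(2) by (simp add: distrib_right)
  also have "\<dots> \<le> n * k" using assms(1) by (intro mult_right_mono) auto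
  finally show ?thesis .
qed

lemma div_mod_block [simp]:
  fixes i j k :: nat
  assumes "j < k"
  shows "(i * k + j) div k = i" "(i * k + j) mod k = j"
  using assms by simp_all

text \<open>
  The additive map that extends the inverse of the crossing map: the exponent of \<open>x\<^sub>i\<^sub>j\<close> counts how
  often \<open>\<alpha>\<^sup>j\<close> is added to the letter in position \<open>i\<close>.
\<close>

definition word_of :: "'f::{finite,field} \<Rightarrow> nat \<Rightarrow> nat vec \<Rightarrow> 'f vec" where
  "word_of \<alpha> n u = vec n (\<lambda>i. \<Sum>j<CARD('f) - 1. of_nat (u $ (i * (CARD('f) - 1) + j)) * \<alpha> ^ (j + 1))"

lemma word_of_carrier [simp]: "word_of \<alpha> n u \<in> carrier_vec n"
  by (simp add: word_of_def)

lemma word_of_index: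
  "i < n \<Longrightarrow> word_of (\<alpha> :: 'f::{finite,field}) n u $ i =
    (\<Sum>j<CARD('f) - 1. of_nat (u $ (i * (CARD('f) - 1) + j)) * \<alpha> ^ (j + 1))"
  by (simp add: word_of_def)

lemma word_of_zero: "word_of (\<alpha> :: 'f::{finite,field}) n (0\<^sub>v (n * (CARD('f) - 1))) = 0\<^sub>v n"
  by (rule eq_vecI) (simp_all add: word_of_def block_index_less)

lemma word_of_add:
  fixes \<alpha> :: "'f::{finite,field}"
  assumes "u \<in> carrier_vec (n * (CARD('f) - 1))" "v \<in> carrier_vec (n * (CARD('f) - 1))"
  shows "word_of \<alpha> n (u + v) = word_of \<alpha> n u + word_of \<alpha> n v"
  using assms
  by (intro eq_vecI) (simp_all add: word_of_def block_index_less distrib_right sum.distrib)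

lemma word_of_unit_vec:
  fixes \<alpha> :: "'f::{finite,field}"
  assumes "i < n" "j < CARD('f) - 1"
  shows "word_of \<alpha> n (unit_vec (n * (CARD('f) - 1)) (i * (CARD('f) - 1) + j)) =
    \<alpha> ^ (j + 1) \<cdot>\<^sub>v unit_vec n i"
proof (rule eq_vecI)
  fix i' assume "i' < dim_vec (\<alpha> ^ (j + 1) \<cdot>\<^sub>v unit_vec n i)"
  then have i': "i' < n" by simp
  have eq: "i' * (CARD('f) - 1) + j' = i * (CARD('f) - 1) + j \<longleftrightarrow> i' = i \<and> j' = j"
    if "j' < CARD('f) - 1" for j'
    using div_mod_block[OF that, of i'] div_mod_block[OF assms(2), of i] by metis
  have "word_of \<alpha> n (unit_vec (n * (CARD('f) - 1)) (i * (CARD('f) - 1) + j)) $ i' =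
      (\<Sum>j'<CARD('f) - 1. if j' = j then (if i' = i then \<alpha> ^ (j + 1) else 0) else 0)"
    unfolding word_of_index[OF i'] using i' assms
    by (intro sum.cong) (auto simp: block_index_less eq)
  also have "\<dots> = (\<alpha> ^ (j + 1) \<cdot>\<^sub>v unit_vec n i) $ i'"
    using i' assms by (simp add: unit_vec_def)
  finally show "word_of \<alpha> n (unit_vec (n * (CARD('f) - 1)) (i * (CARD('f) - 1) + j)) $ i' =
    (\<alpha> ^ (j + 1) \<cdot>\<^sub>v unit_vec n i) $ i'" .
qed (simp add: word_of_def)

lemma crossing_carrier [simp]:
  "a \<in> carrier_vec n \<Longrightarrow> crossing (\<alpha> :: 'f::{finite,field}) a \<in> carrier_vec (n * (CARD('f) - 1))"
  by (simp add: crossing_def carrier_vecD)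

lemma crossing_index:
  fixes \<alpha> :: "'f::{finite,field}"
  assumes "a \<in> carrier_vec n" "i < n" "j < CARD('f) - 1"
  shows "crossing \<alpha> a $ (i * (CARD('f) - 1) + j) = (if a $ i = \<alpha> ^ (j + 1) then 1 else 0)"
  using assms block_index_less[OF assms(2,3)] by (simp add: crossing_def carrier_vecD)

text \<open>
  A nonzero letter equals exactly one of the powers in its block; a letter zero equals none.
\<close>

lemma word_of_crossing:
  fixes \<alpha> :: "'f::{finite,field}"
  assumes prim: "primitive_element \<alpha>" and a: "a \<in> carrier_vec n"
  shows "word_of \<alpha> n (crossing \<alpha> a) = a"
proof (rule eq_vecI)
  fix i assume "i < dim_vec a"
  then have i: "i < n" using a by simp
  have "word_of \<alpha> n (crossing \<alpha> a) $ i =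
      (\<Sum>j<CARD('f) - 1. if a $ i = \<alpha> ^ (j + 1) then \<alpha> ^ (j + 1) else 0)"
    by (unfold word_of_index[OF i], intro sum.cong)
      (simp_all add: crossing_index[OF a i] del: power_Suc)
  also have "\<dots> = a $ i"
  proof (cases "a $ i = 0")
    case True
    then show ?thesis by (auto intro!: sum.neutral)
  next
    case False
    then obtain l where l: "l < CARD('f) - 1" "a $ i = \<alpha> ^ (l + 1)"
      by (rule primitive_power_cases[OF prim])
    then have "(\<Sum>j<CARD('f) - 1. if a $ i = \<alpha> ^ (j + 1) then \<alpha> ^ (j + 1) else 0) =
        (\<Sum>j<CARD('f) - 1. if l = j then \<alpha> ^ (j + 1) else 0)"
      by (intro sum.cong) (simp_all only: lessThan_iff primitive_power_eq_iff[OF prim])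
    then show ?thesis using l by simp
  qed
  finally show "word_of \<alpha> n (crossing \<alpha> a) $ i = a $ i" .
qed (use a in \<open>simp add: word_of_def\<close>)

section \<open>The code ideal as a congruence ideal\<close>

lemma monomial_blocks:
  assumes "u \<in> carrier_vec (n * (q - 1))"
  shows "monomial u = (\<Prod>i<n. \<Prod>j<q - 1. xvar q i (j + 1) ^ (u $ (i * (q - 1) + j)))"
  using assms by (simp add: monomial_def prod.blocks xvar_def carrier_vecD)

text \<open>
  The factor that a letter \<open>c\<close> in position \<open>i\<close> contributes to the monomial of the crossing of a
  word: \<open>x\<^sub>i\<^sub>j\<close> if \<open>c = \<alpha>\<^sup>j\<close>, and \<open>1\<close> if \<open>c = 0\<close>.
\<close>

definition xblock :: "'f::{finite,field} \<Rightarrow> nat \<Rightarrow> 'f \<Rightarrow> 'k::field mpoly" where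
  "xblock \<alpha> i c = (\<Prod>j<CARD('f) - 1. xvar CARD('f) i (j + 1) ^ (if c = \<alpha> ^ (j + 1) then 1 else 0))"

lemma monomial_crossing:
  fixes \<alpha> :: "'f::{finite,field}"
  assumes a: "a \<in> carrier_vec n"
  shows "monomial (crossing \<alpha> a) = (\<Prod>i<n. xblock \<alpha> i (a $ i))"
  unfolding monomial_blocks[OF crossing_carrier[OF a]] xblock_def
  by (intro prod.cong) (simp_all only: lessThan_iff crossing_index[OF a])

lemma xblock_zero:
  assumes "primitive_element \<alpha>"
  shows "xblock \<alpha> i 0 = 1"
proof -
  have "\<alpha> ^ 1 \<in> UNIV - {0}" using assms unfolding primitive_element_def by blast
  then show ?thesis by (simp add: xblock_def)
qed

lemma xblock_power:
  fixes \<alpha> :: "'f::{finite,field}"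
  assumes "primitive_element \<alpha>" "l < CARD('f) - 1"
  shows "xblock \<alpha> i (\<alpha> ^ (l + 1)) = xvar CARD('f) i (l + 1)"
proof -
  have "xblock \<alpha> i (\<alpha> ^ (l + 1)) =
      (\<Prod>j<CARD('f) - 1. if l = j then xvar CARD('f) i (j + 1) else 1)"
    unfolding xblock_def
    by (intro prod.cong)
      (simp_all only: lessThan_iff primitive_power_eq_iff[OF assms] if_distrib[of "(^) _"] power_one_right power_0)
  then show ?thesis using assms(2) by simp
qed

lemma xvar_closed:
  assumes "i < n" "1 \<le> j" "j \<le> q - 1"
  shows "xvar q i j \<in> carrier (mpoly_ring (n * (q - 1)))"
  unfolding xvar_def using assms by (intro Var_closed_mp block_index_less) auto

lemma xblock_closed:
  "i < n \<Longrightarrow> xblock (\<alpha> :: 'f::{finite,field}) i c \<in> carrier (mpoly_ring (n * (CARD('f) - 1)))"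
  unfolding xblock_def by (intro prod_closed_mp power_closed_mp xvar_closed) auto

lemma I_q_generators_closed:
  fixes \<alpha> :: "'f::{finite,field}"
  shows "(\<Union>i<n.
       {xvar CARD('f) i u * xvar CARD('f) i v - xvar CARD('f) i w | u v w.
          u \<in> {1..CARD('f) - 1} \<and> v \<in> {1..CARD('f) - 1} \<and> w \<in> {1..CARD('f) - 1} \<and>
          \<alpha> ^ u + \<alpha> ^ v = \<alpha> ^ w} \<union>
       {xvar CARD('f) i u * xvar CARD('f) i v - 1 | u v.
          u \<in> {1..CARD('f) - 1} \<and> v \<in> {1..CARD('f) - 1} \<and> \<alpha> ^ u + \<alpha> ^ v = 0})
    \<subseteq> carrier (mpoly_ring (n * (CARD('f) - 1)))"
  by (auto intro!: minus_closed_mp mult_closed_mp xvar_closed one_closed_mp)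

lemma ideal_I_q:
  "ideal (I_q (\<alpha> :: 'f::{finite,field}) n) (mpoly_ring (n * (CARD('f) - 1)))"
  unfolding I_q_def by (rule ring.genideal_ideal[OF ring_mpoly_ring I_q_generators_closed])

lemma I_q_generators:
  fixes \<alpha> :: "'f::{finite,field}"
  assumes "i < n" "u < CARD('f) - 1" "v < CARD('f) - 1"
  shows "w < CARD('f) - 1 \<Longrightarrow> \<alpha> ^ (u + 1) + \<alpha> ^ (v + 1) = \<alpha> ^ (w + 1) \<Longrightarrow>
      xvar CARD('f) i (u + 1) * xvar CARD('f) i (v + 1) - xvar CARD('f) i (w + 1) \<in> I_q \<alpha> n"
    and "\<alpha> ^ (u + 1) + \<alpha> ^ (v + 1) = 0 \<Longrightarrow>
      xvar CARD('f) i (u + 1) * xvar CARD('f) i (v + 1) - 1 \<in> I_q \<alpha> n"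
proof -
  have *: "l + 1 \<in> {1..CARD('f) - 1}" if "l < CARD('f) - 1" for l using that by auto
  show "xvar CARD('f) i (u + 1) * xvar CARD('f) i (v + 1) - xvar CARD('f) i (w + 1) \<in> I_q \<alpha> n"
    if "w < CARD('f) - 1" "\<alpha> ^ (u + 1) + \<alpha> ^ (v + 1) = \<alpha> ^ (w + 1)"
    unfolding I_q_def
    using *[OF assms(2)] *[OF assms(3)] *[OF that(1)] that(2) assms(1)
    by (intro subsetD[OF ring.genideal_self[OF ring_mpoly_ring I_q_generators_closed]]) blast
  show "xvar CARD('f) i (u + 1) * xvar CARD('f) i (v + 1) - 1 \<in> I_q \<alpha> n"
    if "\<alpha> ^ (u + 1) + \<alpha> ^ (v + 1) = 0"
    unfolding I_q_def
    using *[OF assms(2)] *[OF assms(3)] that assms(1)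
    by (intro subsetD[OF ring.genideal_self[OF ring_mpoly_ring I_q_generators_closed]]) blast
qed

text \<open>
  This is what the generators of \<open>I_q\<close> encode. If both letters are nonzero, the difference is a
  generator, of the second kind if the sum of the letters vanishes and of the first kind otherwise;
  if one of them is zero, the difference vanishes.
\<close>

lemma xblock_add:
  fixes \<alpha> :: "'f::{finite,field}"
  assumes prim: "primitive_element \<alpha>" and i: "i < n"
  shows "xblock \<alpha> i c * xblock \<alpha> i d - xblock \<alpha> i (c + d) \<in> I_q \<alpha> n"
proof (cases "c = 0 \<or> d = 0")
  case True
  then show ?thesis using ideal_mp_zero[OF ideal_I_q] by (auto simp: xblock_zero[OF prim])
next
  case False
  obtain u where u: "u < CARD('f) - 1" "c = \<alpha> ^ (u + 1)"
    using False primitive_power_cases[OF prim] by metis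
  obtain v where v: "v < CARD('f) - 1" "d = \<alpha> ^ (v + 1)"
    using False primitive_power_cases[OF prim] by metis
  show ?thesis
  proof (cases "c + d = 0")
    case True
    then have "\<alpha> ^ (u + 1) + \<alpha> ^ (v + 1) = 0" by (simp only: u v)
    then show ?thesis
      unfolding True xblock_zero[OF prim]
      unfolding u v xblock_power[OF prim u(1)] xblock_power[OF prim v(1)]
      by (rule I_q_generators(2)[OF i u(1) v(1)])
  next
    case False
    then obtain w where w: "w < CARD('f) - 1" "c + d = \<alpha> ^ (w + 1)"
      by (rule primitive_power_cases[OF prim])
    then have "\<alpha> ^ (u + 1) + \<alpha> ^ (v + 1) = \<alpha> ^ (w + 1)" by (simp only: u v)
    then show ?thesis
      unfolding w
      unfolding u v xblock_power[OF prim u(1)] xblock_power[OF prim v(1)] xblock_power[OF prim w(1)]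
      by (rule I_q_generators(1)[OF i u(1) v(1) w(1)])
  qed
qed

lemma xblock_of_nat_mult:
  fixes \<alpha> :: "'f::{finite,field}"
  assumes prim: "primitive_element \<alpha>" and i: "i < n"
  shows "(xblock \<alpha> i c ^ e - xblock \<alpha> i (of_nat e * c) :: 'k::field mpoly) \<in> I_q \<alpha> n"
proof (induction e)
  case 0
  then show ?case using ideal_mp_zero[OF ideal_I_q] by (simp add: xblock_zero[OF prim])
next
  case (Suc e)
  have "(xblock \<alpha> i c * xblock \<alpha> i c ^ e -
      xblock \<alpha> i c * xblock \<alpha> i (of_nat e * c) :: 'k mpoly) \<in> I_q \<alpha> n"
    using Suc ideal_mp_zero[OF ideal_I_q] i
    by (intro ideal_diff_mult[OF ideal_I_q]) (auto intro: power_closed_mp xblock_closed)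
  from ideal_diff_trans[OF ideal_I_q this xblock_add[OF prim i]] show ?case
    by (simp add: distrib_right)
qed

lemma xblock_sum:
  fixes \<alpha> :: "'f::{finite,field}"
  assumes prim: "primitive_element \<alpha>" and i: "i < n" and "finite A"
  shows "((\<Prod>j\<in>A. xblock \<alpha> i (c j)) - xblock \<alpha> i (\<Sum>j\<in>A. c j) :: 'k::field mpoly) \<in> I_q \<alpha> n"
  using assms(3)
proof (induction A)
  case empty
  then show ?case using ideal_mp_zero[OF ideal_I_q] by (simp add: xblock_zero[OF prim])
next
  case (insert x A)
  have "(xblock \<alpha> i (c x) * (\<Prod>j\<in>A. xblock \<alpha> i (c j)) -
      xblock \<alpha> i (c x) * xblock \<alpha> i (\<Sum>j\<in>A. c j) :: 'k mpoly) \<in> I_q \<alpha> n"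
    using insert ideal_mp_zero[OF ideal_I_q] i
    by (intro ideal_diff_mult[OF ideal_I_q]) (auto intro: prod_closed_mp xblock_closed)
  from ideal_diff_trans[OF ideal_I_q this xblock_add[OF prim i]] show ?case
    using insert by simp
qed

text \<open>
  In each block, \<open>x\<^sub>i\<^sub>j\<close> is the factor of the letter \<open>\<alpha>\<^sup>j\<close>. Since letters multiply like field
  elements add, the product of all variables of the block, with their exponents, is congruent to
  the factor of the single letter \<open>\<Sum>\<^sub>j u\<^sub>i\<^sub>j \<alpha>\<^sup>j\<close>.
\<close>

lemma monomial_reduces_to_crossing:
  fixes \<alpha> :: "'f::{finite,field}"
  assumes prim: "primitive_element \<alpha>" and u: "u \<in> carrier_vec (n * (CARD('f) - 1))"
  shows "monomial u - monomial (crossing \<alpha> (word_of \<alpha> n u)) \<in> I_q \<alpha> n"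
proof -
  have "(\<Prod>j<CARD('f) - 1. xvar CARD('f) i (j + 1) ^ (u $ (i * (CARD('f) - 1) + j))) -
      xblock \<alpha> i (word_of \<alpha> n u $ i) \<in> I_q \<alpha> n" if i: "i < n" for i
  proof -
    let ?e = "\<lambda>j. u $ (i * (CARD('f) - 1) + j)"
    have "(\<Prod>j<CARD('f) - 1. xvar CARD('f) i (j + 1) ^ ?e j) -
        (\<Prod>j<CARD('f) - 1. xblock \<alpha> i (of_nat (?e j) * \<alpha> ^ (j + 1))) \<in> I_q \<alpha> n"
    proof (rule ideal_diff_prod[OF ideal_I_q])
      fix j assume "j \<in> {..<CARD('f) - 1}"
      then show "xvar CARD('f) i (j + 1) ^ ?e j - xblock \<alpha> i (of_nat (?e j) * \<alpha> ^ (j + 1)) \<in> I_q \<alpha> n"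
        using xblock_of_nat_mult[OF prim i, of "\<alpha> ^ (j + 1)" "?e j"]
        by (simp only: lessThan_iff xblock_power[OF prim])
    qed (auto intro!: power_closed_mp xvar_closed xblock_closed i)
    from ideal_diff_trans[OF ideal_I_q this xblock_sum[OF prim i]] show ?thesis
      using i by (simp add: word_of_def)
  qed
  then show ?thesis
    unfolding monomial_blocks[OF u] monomial_crossing[OF word_of_carrier]
    by (intro ideal_diff_prod[OF ideal_I_q])
      (auto intro!: prod_closed_mp power_closed_mp xvar_closed xblock_closed)
qed

text \<open>
  Crossings are sent back to the given words by \<open>word_of\<close>, and the two monomials in a generator
  of \<open>I_q\<close> belong to exponent vectors with equal words, whose difference \<open>0\<close> lies in \<open>C\<close>; this
  gives one inclusion. Conversely both monomials of a generator on the right reduce to crossings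
  modulo \<open>I_q\<close>.
\<close>

lemma code_ideal_eq_congruence_ideal:
  fixes \<alpha> :: "'f::{finite,field}"
  assumes prim: "primitive_element \<alpha>" and C: "0\<^sub>v n \<in> C"
  shows "(code_ideal \<alpha> n C :: 'k::field mpoly set) =
    Idl\<^bsub>mpoly_ring (n * (CARD('f) - 1))\<^esub>
      {monomial u - monomial v | u v.
        u \<in> carrier_vec (n * (CARD('f) - 1)) \<and> v \<in> carrier_vec (n * (CARD('f) - 1)) \<and>
        word_of \<alpha> n u - word_of \<alpha> n v \<in> C}"
    (is "_ = Idl\<^bsub>?R\<^esub> ?G")
proof
  let ?N = "n * (CARD('f) - 1)"
  let ?W = "{monomial (crossing \<alpha> a) - monomial (crossing \<alpha> b) | a b.
          a \<in> carrier_vec n \<and> b \<in> carrier_vec n \<and> a - b \<in> C} :: 'k mpoly set"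
  interpret R: Ring.ring ?R by (rule ring_mpoly_ring)
  have G: "?G \<subseteq> carrier ?R" by (auto intro!: minus_closed_mp monomial_closed)
  have W: "?W \<subseteq> carrier ?R" by (auto intro!: minus_closed_mp monomial_closed)
  have J: "ideal (Idl\<^bsub>?R\<^esub> ?G) ?R" by (rule R.genideal_ideal[OF G])
  have IW: "ideal (Idl\<^bsub>?R\<^esub> ?W) ?R" by (rule R.genideal_ideal[OF W])
  have genJ: "monomial u - monomial v \<in> Idl\<^bsub>?R\<^esub> ?G"
    if "u \<in> carrier_vec ?N" "v \<in> carrier_vec ?N" "word_of \<alpha> n u - word_of \<alpha> n v \<in> C" for u v
    using that by (intro subsetD[OF R.genideal_self[OF G]]) blast
  have WJ: "Idl\<^bsub>?R\<^esub> ?W \<subseteq> Idl\<^bsub>?R\<^esub> ?G"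
  proof (rule R.genideal_minimal[OF J], rule subsetI)
    fix f :: "'k mpoly" assume "f \<in> ?W"
    then obtain a b where "f = monomial (crossing \<alpha> a) - monomial (crossing \<alpha> b)"
      "a \<in> carrier_vec n" "b \<in> carrier_vec n" "a - b \<in> C" by blast
    then show "f \<in> Idl\<^bsub>?R\<^esub> ?G"
      by (simp only:) (rule genJ, simp_all add: word_of_crossing[OF prim])
  qed
  have QJ: "I_q \<alpha> n \<subseteq> Idl\<^bsub>?R\<^esub> ?G"
    unfolding I_q_def
  proof (rule R.genideal_minimal[OF J], rule UN_least, rule Un_least; rule subsetI)
    fix i and f :: "'k mpoly"
    assume "i \<in> {..<n}"
    then have i: "i < n" by simp
    \<comment> \<open>The exponent vector of the variable \<open>x\<^sub>i\<^sub>j\<close>.\<close>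
    define e :: "nat \<Rightarrow> nat vec" where "e j = unit_vec ?N (i * (CARD('f) - 1) + (j - 1))" for j
    have e [simp]: "e j \<in> carrier_vec ?N" for j by (simp add: e_def)
    have x: "xvar CARD('f) i j = monomial (e j)" if "j \<in> {1..CARD('f) - 1}" for j
      using that i unfolding xvar_def e_def
      by (intro monomial_unit_vec[symmetric] block_index_less) auto
    have w: "word_of \<alpha> n (e j) = \<alpha> ^ j \<cdot>\<^sub>v unit_vec n i" if "j \<in> {1..CARD('f) - 1}" for j
      using that i word_of_unit_vec[of i n "j - 1" \<alpha>] by (auto simp: e_def)
    {
      assume "f \<in> {xvar CARD('f) i u * xvar CARD('f) i v - xvar CARD('f) i w | u v w.
          u \<in> {1..CARD('f) - 1} \<and> v \<in> {1..CARD('f) - 1} \<and> w \<in> {1..CARD('f) - 1} \<and>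
          \<alpha> ^ u + \<alpha> ^ v = \<alpha> ^ w}"
      then obtain u v l where f: "f = xvar CARD('f) i u * xvar CARD('f) i v - xvar CARD('f) i l"
        and uvl: "u \<in> {1..CARD('f) - 1}" "v \<in> {1..CARD('f) - 1}" "l \<in> {1..CARD('f) - 1}"
        and s: "\<alpha> ^ u + \<alpha> ^ v = \<alpha> ^ l" by blast
      have "f = monomial (e u + e v) - monomial (e l)"
        by (simp only: f x[OF uvl(1)] x[OF uvl(2)] x[OF uvl(3)] monomial_add[OF e e])
      moreover have "word_of \<alpha> n (e u + e v) - word_of \<alpha> n (e l) = 0\<^sub>v n"
        by (simp add: word_of_add w[OF uvl(1)] w[OF uvl(2)] w[OF uvl(3)] flip: s
            add_smult_distrib_vec)
      ultimately show "f \<in> Idl\<^bsub>?R\<^esub> ?G" using C by (simp only:) (rule genJ, simp_all)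
    }
    {
      assume "f \<in> {xvar CARD('f) i u * xvar CARD('f) i v - 1 | u v.
          u \<in> {1..CARD('f) - 1} \<and> v \<in> {1..CARD('f) - 1} \<and> \<alpha> ^ u + \<alpha> ^ v = 0}"
      then obtain u v where f: "f = xvar CARD('f) i u * xvar CARD('f) i v - 1"
        and uv: "u \<in> {1..CARD('f) - 1}" "v \<in> {1..CARD('f) - 1}"
        and s: "\<alpha> ^ u + \<alpha> ^ v = 0" by blast
      have "f = monomial (e u + e v) - monomial (0\<^sub>v ?N)"
        by (simp only: f x[OF uv(1)] x[OF uv(2)] monomial_zero monomial_add[OF e e])
      moreover have "word_of \<alpha> n (e u + e v) - word_of \<alpha> n (0\<^sub>v ?N) = 0\<^sub>v n"
        by (simp add: word_of_add w[OF uv(1)] w[OF uv(2)] s word_of_zero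
            flip: add_smult_distrib_vec) (rule eq_vecI, simp_all)
      ultimately show "f \<in> Idl\<^bsub>?R\<^esub> ?G" using C by (simp only:) (rule genJ, simp_all)
    }
  qed
  have mem: "f \<in> code_ideal \<alpha> n C \<longleftrightarrow> (\<exists>g\<in>Idl\<^bsub>?R\<^esub> ?W. \<exists>h\<in>I_q \<alpha> n. f = g + h)" for f :: "'k mpoly"
    unfolding code_ideal_def set_add_def' mpoly_ring_simps by blast
  show "code_ideal \<alpha> n C \<subseteq> Idl\<^bsub>?R\<^esub> ?G"
  proof
    fix f :: "'k mpoly" assume "f \<in> code_ideal \<alpha> n C"
    then obtain g h where "f = g + h" "g \<in> Idl\<^bsub>?R\<^esub> ?W" "h \<in> I_q \<alpha> n"
      unfolding mem by blast
    then show "f \<in> Idl\<^bsub>?R\<^esub> ?G" using WJ QJ ideal_mp_add[OF J] by blast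
  qed
  have I: "ideal (code_ideal \<alpha> n C :: 'k mpoly set) ?R"
    unfolding code_ideal_def by (rule R.add_ideals[OF IW ideal_I_q])
  have subW: "f \<in> code_ideal \<alpha> n C" if "f \<in> ?W" for f :: "'k mpoly"
    unfolding mem
  proof (intro bexI)
    show "f = f + 0" by simp
  qed (use that R.genideal_self[OF W] ideal_mp_zero[OF ideal_I_q] in blast)+
  have subQ: "f \<in> code_ideal \<alpha> n C" if "f \<in> I_q \<alpha> n" for f :: "'k mpoly"
    unfolding mem
  proof (intro bexI)
    show "f = 0 + f" by simp
  qed (use that ideal_mp_zero[OF IW] in blast)+
  show "Idl\<^bsub>?R\<^esub> ?G \<subseteq> code_ideal \<alpha> n C"
  proof (rule R.genideal_minimal[OF I], rule subsetI)
    fix f :: "'k mpoly" assume "f \<in> ?G"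
    then obtain u v where f: "f = monomial u - monomial v"
      and uv: "u \<in> carrier_vec ?N" "v \<in> carrier_vec ?N" "word_of \<alpha> n u - word_of \<alpha> n v \<in> C"
      by blast
    let ?c = "\<lambda>u. monomial (crossing \<alpha> (word_of \<alpha> n u)) :: 'k mpoly"
    have 1: "monomial u - ?c u \<in> code_ideal \<alpha> n C" "monomial v - ?c v \<in> code_ideal \<alpha> n C"
      using uv monomial_reduces_to_crossing[OF prim] subQ by blast+
    have 2: "?c u - ?c v \<in> code_ideal \<alpha> n C"
      by (rule subW) (use uv(3) word_of_carrier in blast)
    from ideal_mp_minus[OF I ideal_diff_trans[OF I 1(1) 2] 1(2)]
    show "f \<in> code_ideal \<alpha> n C" by (simp add: f)
  qed
qed

section \<open>Coordinates over the prime subfield\<close>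

lemma of_int_eq_0_iff_finite_field:
  assumes "prime p" "CARD('f::{finite,field}) = p ^ r"
  shows "of_int z = (0::'f) \<longleftrightarrow> int p dvd z"
proof -
  have "CHAR('f) dvd p ^ r" using CHAR_dvd_CARD[where 'a = 'f] assms(2) by simp
  moreover have "prime CHAR('f)"
    by (rule prime_CHAR_semidom) (simp add: finite_imp_CHAR_pos)
  ultimately have "CHAR('f) = p"
    using assms(1) prime_dvd_power primes_dvd_imp_eq by blast
  then show ?thesis by (simp add: of_int_eq_0_iff_char_dvd)
qed

text \<open>
  The inverse of \<open>c\<close> is the power \<open>c\<^sup>q\<^sup>-\<^sup>2\<close>, and the image of the integers is closed under powers.
\<close>

lemma inverse_in_range_of_int:
  fixes c :: "'f::{finite,field}"
  assumes "c \<in> range of_int" "c \<noteq> 0"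
  shows "inverse c \<in> range of_int"
proof -
  have "card {0::'f, 1} \<le> CARD('f)" by (rule card_mono) auto
  then have "CARD('f) - 1 = Suc (CARD('f) - 2)" by simp
  then have "c * c ^ (CARD('f) - 2) = c ^ (CARD('f) - 1)" by (simp only: power_Suc)
  then have "inverse c = c ^ (CARD('f) - 2)"
    using power_card_minus_one[OF assms(2)] by (intro inverse_unique) simp
  moreover obtain z where "c = of_int z" using assms(1) by blast
  ultimately show ?thesis by (metis of_int_power rangeI)
qed

lemma range_of_int_closed:
  "x \<in> range of_int \<Longrightarrow> y \<in> range of_int \<Longrightarrow> x + y \<in> range of_int"
  "x \<in> range of_int \<Longrightarrow> y \<in> range of_int \<Longrightarrow> x * y \<in> range of_int"
  "x \<in> range of_int \<Longrightarrow> - x \<in> range of_int"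
  "(0::'a::ring_1) \<in> range of_int" "(1::'a) \<in> range of_int"
  by (auto simp flip: of_int_add of_int_mult of_int_minus)
    (metis of_int_0 rangeI, metis of_int_1 rangeI)

lemma field_prime_subfield: "Ring.field (prime_subfield :: 'f::{finite,field} ring)"
proof (rule cring.cring_fieldI2)
  show "cring (prime_subfield :: 'f ring)"
  proof (rule cringI)
    show "abelian_group (prime_subfield :: 'f ring)"
    proof (rule abelian_groupI)
      fix x :: 'f assume "x \<in> carrier prime_subfield"
      then show "\<exists>y\<in>carrier prime_subfield. y \<oplus>\<^bsub>prime_subfield\<^esub> x = \<zero>\<^bsub>prime_subfield\<^esub>"
        by (intro bexI[of _ "- x"]) (simp_all add: prime_subfield_def range_of_int_closed)
    qed (simp_all add: prime_subfield_def range_of_int_closed ac_simps)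
    show "Group.comm_monoid (prime_subfield :: 'f ring)"
      by (rule comm_monoidI) (simp_all add: prime_subfield_def range_of_int_closed ac_simps)
  qed (simp add: prime_subfield_def distrib_right)
next
  fix a :: 'f assume "a \<in> carrier prime_subfield" "a \<noteq> \<zero>\<^bsub>prime_subfield\<^esub>"
  then show "\<exists>b\<in>carrier prime_subfield. a \<otimes>\<^bsub>prime_subfield\<^esub> b = \<one>\<^bsub>prime_subfield\<^esub>"
    using inverse_in_range_of_int[of a]
    by (intro bexI[of _ "inverse a"]) (simp_all add: prime_subfield_def)
qed (simp add: prime_subfield_def)

text \<open>
  The notion of a basis comes from the locale of vector spaces, so that its definition can be used
  only once the field is known to be a vector space over the prime subfield.
\<close>

lemma vectorspace_field_over_prime_subfield:
  "vectorspace (prime_subfield :: 'f::{finite,field} ring) field_as_space"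
proof -
  interpret K: Ring.field "prime_subfield :: 'f ring" by (rule field_prime_subfield)
  have "abelian_group (field_as_space :: ('f, 'f) module)"
    by (rule abelian_groupI)
      (auto simp: field_as_space_def ac_simps intro: exI[of _ "- _"])
  then have "Module.module (prime_subfield :: 'f ring) field_as_space"
    by (intro Module.module.intro module_axioms.intro K.cring_axioms)
      (simp_all add: field_as_space_def prime_subfield_def algebra_simps)
  then show ?thesis
    by (intro vectorspace.intro K.field_axioms)
qed

lemma finsum_field_as_space:
  "finsum (field_as_space :: ('f::{finite,field}, 'f) module) f A = sum f A" if "finite A"
proof -
  interpret V: vectorspace "prime_subfield :: 'f ring" field_as_space
    by (rule vectorspace_field_over_prime_subfield)
  have eqs: "carrier (field_as_space :: ('f, 'f) module) = UNIV"
    "add (field_as_space :: ('f, 'f) module) = (+)" "zero (field_as_space :: ('f, 'f) module) = 0"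
    by (simp_all add: field_as_space_def)
  show ?thesis
    using that by (induction A) (simp_all add: eqs)
qed

text \<open>
  The library speaks of linear combinations over sets of vectors. As \<open>b\<close> is injective on the
  indices, they can be rewritten as sums over the indices, the form in which \<open>coord\<close> uses them.
\<close>

lemma
  fixes b :: "nat \<Rightarrow> 'f::{finite,field}"
  assumes "prime_basis r b"
  shows prime_basis_spans: "\<exists>a. (\<forall>j<r. a j \<in> range of_int) \<and> x = (\<Sum>j<r. a j * b j)"
    and prime_basis_independent:
      "\<And>a j. (\<forall>j<r. a j \<in> range of_int) \<Longrightarrow> (\<Sum>j<r. a j * b j) = 0 \<Longrightarrow> j < r \<Longrightarrow> a j = 0"
proof -
  interpret V: vectorspace "prime_subfield :: 'f ring" field_as_space
    by (rule vectorspace_field_over_prime_subfield)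
  have inj: "inj_on b {..<r}" and basis: "V.basis (b ` {..<r})"
    using assms by (simp_all add: prime_basis_def)
  have carr: "carrier (field_as_space :: ('f, 'f) module) = UNIV"
    "carrier (prime_subfield :: 'f ring) = range of_int"
    "zero (field_as_space :: ('f, 'f) module) = 0"
    "zero (prime_subfield :: 'f ring) = 0"
    by (simp_all add: field_as_space_def prime_subfield_def)
  have lin: "V.lincomb a A = (\<Sum>v\<in>A. a v * v)" if "finite A" for a A
    unfolding V.lincomb_def using that by (simp add: finsum_field_as_space, simp add: field_as_space_def)
  show "\<exists>a. (\<forall>j<r. a j \<in> range of_int) \<and> x = (\<Sum>j<r. a j * b j)"
  proof -
    have "x \<in> V.span (b ` {..<r})" using basis by (simp add: V.basis_def carr)
    then obtain a A where A: "finite A" "A \<subseteq> b ` {..<r}" "a \<in> A \<rightarrow> range of_int" "x = V.lincomb a A"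
      unfolding V.span_def carr by blast
    let ?a = "\<lambda>v. if v \<in> A then a v else 0"
    have "x = (\<Sum>v\<in>A. a v * v)" using A by (simp add: lin)
    also have "\<dots> = (\<Sum>v\<in>b ` {..<r}. ?a v * v)"
      using A by (intro sum.mono_neutral_cong_left) auto
    also have "\<dots> = (\<Sum>j<r. ?a (b j) * b j)" using inj by (simp add: sum.reindex)
    finally show ?thesis
      using A(3) range_of_int_closed(4) by (intro exI[of _ "\<lambda>j. ?a (b j)"]) (auto simp del: image_iff)
  qed
  show "a j = 0" if a: "\<forall>j<r. a j \<in> range of_int" "(\<Sum>j<r. a j * b j) = 0" "j < r" for a j
  proof (rule ccontr)
    assume "a j \<noteq> 0"
    define c where "c v = a (the_inv_into {..<r} b v)" for v
    have cb: "c (b i) = a i" if "i < r" for i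
      using that by (simp add: c_def the_inv_into_f_f[OF inj])
    have "V.lincomb c (b ` {..<r}) = (\<Sum>j<r. c (b j) * b j)"
      using inj by (simp add: lin sum.reindex)
    also have "\<dots> = 0" using a(2) cb by simp
    finally have "V.lin_dep (b ` {..<r})"
      using a cb \<open>a j \<noteq> 0\<close>
      by (intro V.lin_dep_crit[of "b ` {..<r}" _ c "b j"]) (auto simp: carr Pi_iff simp del: image_iff)
    then show False using basis by (simp add: V.basis_def)
  qed
qed

lemma coord_eqI:
  fixes b :: "nat \<Rightarrow> 'f::{finite,field}"
  assumes basis: "prime_basis r b" and s: "s < r"
    and a: "\<forall>j<r. a j \<in> range of_int" and x: "x = (\<Sum>j<r. a j * b j)"
  shows "coord r b s x = a s"
  unfolding coord_def
proof (rule the_equality)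
  show "\<exists>a'. (\<forall>j<r. a' j \<in> range of_int) \<and> x = (\<Sum>j<r. a' j * b j) \<and> a s = a' s"
    using a x by blast
next
  fix c assume "\<exists>a'. (\<forall>j<r. a' j \<in> range of_int) \<and> x = (\<Sum>j<r. a' j * b j) \<and> c = a' s"
  then obtain a' where a': "\<forall>j<r. a' j \<in> range of_int" "x = (\<Sum>j<r. a' j * b j)" "c = a' s"
    by blast
  have "(\<Sum>j<r. (a' j - a j) * b j) = 0"
    using a'(2) x by (simp add: left_diff_distrib sum_subtractf)
  moreover have "a' j - a j \<in> range of_int" if "j < r" for j
    using that a a' range_of_int_closed(1)[OF _ range_of_int_closed(3)] by fastforce
  ultimately have "a' s - a s = 0"
    using prime_basis_independent[OF basis, of "\<lambda>j. a' j - a j"] s by blast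
  then show "c = a s" using a'(3) by simp
qed

lemma coord_expansion:
  fixes b :: "nat \<Rightarrow> 'f::{finite,field}"
  assumes basis: "prime_basis r b"
  shows "s < r \<Longrightarrow> coord r b s x \<in> range of_int" "x = (\<Sum>j<r. coord r b j x * b j)"
proof -
  obtain a where a: "\<forall>j<r. a j \<in> range of_int" "x = (\<Sum>j<r. a j * b j)"
    using prime_basis_spans[OF basis] by blast
  have c: "coord r b s x = a s" if "s < r" for s by (rule coord_eqI[OF basis that a])
  show "s < r \<Longrightarrow> coord r b s x \<in> range of_int" using a c by simp
  show "x = (\<Sum>j<r. coord r b j x * b j)" using a(2) c by simp
qed

lemma coord_eq_iff:
  fixes b :: "nat \<Rightarrow> 'f::{finite,field}"
  assumes basis: "prime_basis r b"
  shows "(\<forall>s<r. coord r b s x = coord r b s y) \<longleftrightarrow> x = y"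
proof
  assume "\<forall>s<r. coord r b s x = coord r b s y"
  then have "(\<Sum>j<r. coord r b j x * b j) = (\<Sum>j<r. coord r b j y * b j)" by simp
  then show "x = y" by (simp only: coord_expansion(2)[OF basis, symmetric])
qed simp

text \<open>
  Coordinates are linear over the prime subfield; natural multiples suffice because exponents are
  natural numbers.
\<close>

lemma coord_sum_of_nat_mult:
  fixes b :: "nat \<Rightarrow> 'f::{finite,field}"
  assumes basis: "prime_basis r b" and s: "s < r"
  shows "coord r b s (\<Sum>t\<in>T. of_nat (e t) * x t) = (\<Sum>t\<in>T. of_nat (e t) * coord r b s (x t))"
proof (rule coord_eqI[OF basis s])
  have "(\<Sum>t\<in>T. of_nat (e t) * x t) = (\<Sum>t\<in>T. of_nat (e t) * (\<Sum>j<r. coord r b j (x t) * b j))"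
    using coord_expansion(2)[OF basis] by simp
  also have "\<dots> = (\<Sum>j<r. (\<Sum>t\<in>T. of_nat (e t) * coord r b j (x t)) * b j)"
    unfolding sum_distrib_left sum_distrib_right mult.assoc by (rule sum.swap)
  finally show "(\<Sum>t\<in>T. of_nat (e t) * x t) = \<dots>" .
  have "of_nat (e t) * coord r b j (x t) \<in> range of_int" if "j < r" for t j
    using coord_expansion(1)[OF basis that] by (metis imageE of_int_mult of_int_of_nat_eq rangeI)
  then show "\<forall>j<r. (\<Sum>t\<in>T. of_nat (e t) * coord r b j (x t)) \<in> range of_int"
    by (induction T rule: infinite_finite_induct) (simp_all add: range_of_int_closed)
qed

section \<open>The fibres of the matrix\<close>

lemma H_plus_mult_append:
  assumes D: "D \<in> carrier_mat M N" and u: "u \<in> carrier_vec N" and y: "y \<in> carrier_vec M"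
  shows "H_plus p D *\<^sub>v map_vec int (u @\<^sub>v y) =
    (D *\<^sub>v map_vec int u + int p \<cdot>\<^sub>v map_vec int y) @\<^sub>v 0\<^sub>v 0"
proof -
  have "H_plus p D = four_block_mat D (int p \<cdot>\<^sub>m 1\<^sub>m M) (0\<^sub>m 0 N) (0\<^sub>m 0 M)"
    using D by (simp add: H_plus_def carrier_matD)
  moreover have "map_vec int (u @\<^sub>v y) = map_vec int u @\<^sub>v map_vec int y"
    by (rule eq_vecI) auto
  moreover have "four_block_mat D (int p \<cdot>\<^sub>m 1\<^sub>m M) (0\<^sub>m 0 N) (0\<^sub>m 0 M) *\<^sub>v
        (map_vec int u @\<^sub>v map_vec int y) =
      (D *\<^sub>v map_vec int u + (int p \<cdot>\<^sub>m 1\<^sub>m M) *\<^sub>v map_vec int y) @\<^sub>v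
      (0\<^sub>m 0 N *\<^sub>v map_vec int u + 0\<^sub>m 0 M *\<^sub>v map_vec int y)"
    using assms by (intro four_block_mat_mult_vec) auto
  moreover have "(int p \<cdot>\<^sub>m 1\<^sub>m M) *\<^sub>v map_vec int y = int p \<cdot>\<^sub>v map_vec int y"
    using y by (intro eq_vecI) auto
  moreover have "0\<^sub>m 0 N *\<^sub>v map_vec int u + 0\<^sub>m 0 M *\<^sub>v map_vec int y = 0\<^sub>v 0"
    by (rule eq_vecI) auto
  ultimately show ?thesis by simp
qed

text \<open>
  The columns \<open>p I\<close> allow each row to be corrected independently by any multiple of \<open>p\<close>. The
  correction may have either sign, while exponents are natural numbers; this is why \<open>y\<close> variables
  are needed on both sides.
\<close>

lemma H_plus_fibre_iff:
  assumes D: "D \<in> carrier_mat M N" and u: "u \<in> carrier_vec N" and v: "v \<in> carrier_vec N"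
  shows "(\<exists>y\<in>carrier_vec M. \<exists>z\<in>carrier_vec M.
      H_plus p D *\<^sub>v map_vec int (u @\<^sub>v y) = H_plus p D *\<^sub>v map_vec int (v @\<^sub>v z)) \<longleftrightarrow>
    (\<forall>i<M. int p dvd (D *\<^sub>v map_vec int u) $ i - (D *\<^sub>v map_vec int v) $ i)"
    (is "?L \<longleftrightarrow> ?R")
proof -
  define \<delta> where "\<delta> i = (D *\<^sub>v map_vec int u) $ i - (D *\<^sub>v map_vec int v) $ i" for i
  have eq: "H_plus p D *\<^sub>v map_vec int (u @\<^sub>v y) = H_plus p D *\<^sub>v map_vec int (v @\<^sub>v z) \<longleftrightarrow>
      (\<forall>i<M. \<delta> i = int p * (int (z $ i) - int (y $ i)))"
    if yz: "y \<in> carrier_vec M" "z \<in> carrier_vec M" for y z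
  proof -
    let ?a = "D *\<^sub>v map_vec int u + int p \<cdot>\<^sub>v map_vec int y"
    let ?b = "D *\<^sub>v map_vec int v + int p \<cdot>\<^sub>v map_vec int z"
    have "H_plus p D *\<^sub>v map_vec int (u @\<^sub>v y) = H_plus p D *\<^sub>v map_vec int (v @\<^sub>v z) \<longleftrightarrow> ?a = ?b"
      unfolding H_plus_mult_append[OF D u yz(1)] H_plus_mult_append[OF D v yz(2)]
      using D u v yz by (intro append_vec_eq[of _ M, THEN trans]) auto
    also have "\<dots> \<longleftrightarrow> (\<forall>i<M. ?a $ i = ?b $ i)" using D yz by (simp add: vec_eq_iff del: index_mult_mat_vec)
    also have "\<dots> \<longleftrightarrow> (\<forall>i<M. \<delta> i = int p * (int (z $ i) - int (y $ i)))"
    proof (intro all_cong)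
      fix i assume "i < M"
      then have "?a $ i = (D *\<^sub>v map_vec int u) $ i + int p * int (y $ i)"
        "?b $ i = (D *\<^sub>v map_vec int v) $ i + int p * int (z $ i)"
        using D yz by (simp_all del: index_mult_mat_vec)
      then show "?a $ i = ?b $ i \<longleftrightarrow> \<delta> i = int p * (int (z $ i) - int (y $ i))"
        unfolding \<delta>_def by (simp only: right_diff_distrib) linarith
    qed
    finally show ?thesis .
  qed
  show ?thesis
    unfolding \<delta>_def[symmetric]
  proof
    assume ?L
    then show "\<forall>i<M. int p dvd \<delta> i" using eq by (metis dvd_triv_left)
  next
    assume R: "\<forall>i<M. int p dvd \<delta> i"
    define e where "e i = \<delta> i div int p" for i
    \<comment> \<open>The positive part of the quotient goes into \<open>z\<close>, the negative part into \<open>y\<close>.\<close>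
    have "\<delta> i = int p * (int (nat (e i)) - int (nat (- e i)))" if "i < M" for i
    proof -
      have "\<delta> i = int p * e i" using R that by (simp add: e_def dvd_mult_div_cancel)
      moreover have "int (nat (e i)) - int (nat (- e i)) = e i" by simp
      ultimately show ?thesis by (simp only:)
    qed
    then have "\<forall>i<M. \<delta> i = int p * (int (vec M (\<lambda>i. nat (e i)) $ i) - int (vec M (\<lambda>i. nat (- e i)) $ i))"
      by simp
    then show ?L
      by (intro bexI[of _ "vec M (\<lambda>i. nat (- e i))"] bexI[of _ "vec M (\<lambda>i. nat (e i))"]) (simp_all only: eq vec_carrier)
  qed
qed

text \<open>
  By construction the entry in row \<open>(i, s)\<close> and column \<open>(j, l)\<close> is the \<open>s\<close>th coordinate of
  \<open>\<alpha>\<^sup>l h\<^sub>i\<^sub>j\<close>. Since coordinates commute with sums of natural multiples, the row sum is the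
  coordinate of \<open>\<Sum>\<^sub>j h\<^sub>i\<^sub>j \<Sum>\<^sub>l u\<^sub>j\<^sub>l \<alpha>\<^sup>l\<close>, an entry of the syndrome of the word of \<open>u\<close>.
\<close>

lemma of_int_lift_mult:
  fixes \<alpha> :: "'f::{finite,field}"
  assumes basis: "prime_basis r b" and H: "H \<in> carrier_mat m n"
    and D: "D \<in> carrier_mat (m * r) (n * (CARD('f) - 1))"
    and De: "map_mat of_int D = H_plus_e \<alpha> r b H"
    and u: "u \<in> carrier_vec (n * (CARD('f) - 1))" and i: "i < m" and s: "s < r"
  shows "of_int ((D *\<^sub>v map_vec int u) $ (i * r + s)) = coord r b s ((H *\<^sub>v word_of \<alpha> n u) $ i)"
proof -
  let ?Q = "CARD('f) - 1"
  have row: "i * r + s < m * r" by (rule block_index_less[OF i s])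
  have ent: "of_int (D $$ (i * r + s, j * ?Q + l)) = coord r b s (\<alpha> ^ (l + 1) * H $$ (i, j))"
    if "j < n" "l < ?Q" for j l
  proof -
    have "of_int (D $$ (i * r + s, j * ?Q + l)) = H_plus_e \<alpha> r b H $$ (i * r + s, j * ?Q + l)"
      using D row block_index_less[OF that] by (simp flip: De)
    then show ?thesis
      using H row s that block_index_less[OF that] by (simp add: H_plus_e_def)
  qed
  have "(D *\<^sub>v map_vec int u) $ (i * r + s) =
      (\<Sum>t<n * ?Q. D $$ (i * r + s, t) * int (u $ t))"
    using D u row by (simp add: scalar_prod_def lessThan_atLeast0)
  then have "of_int ((D *\<^sub>v map_vec int u) $ (i * r + s)) =
      (\<Sum>t<n * ?Q. of_nat (u $ t) * (of_int (D $$ (i * r + s, t)) :: 'f))"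
    by (simp add: mult.commute)
  also have "\<dots> = (\<Sum>j<n. \<Sum>l<?Q. of_nat (u $ (j * ?Q + l)) * coord r b s (\<alpha> ^ (l + 1) * H $$ (i, j)))"
    unfolding sum.blocks by (intro sum.cong) (simp_all only: lessThan_iff ent)
  also have "\<dots> = (\<Sum>(j, l)\<in>{..<n} \<times> {..<?Q}.
      of_nat (u $ (j * ?Q + l)) * coord r b s (\<alpha> ^ (l + 1) * H $$ (i, j)))"
    by (rule sum.cartesian_product)
  also have "\<dots> = coord r b s (\<Sum>(j, l)\<in>{..<n} \<times> {..<?Q}.
      of_nat (u $ (j * ?Q + l)) * (\<alpha> ^ (l + 1) * H $$ (i, j)))"
    using coord_sum_of_nat_mult[OF basis s, of "\<lambda>(j, l). u $ (j * ?Q + l)"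
        "\<lambda>(j, l). \<alpha> ^ (l + 1) * H $$ (i, j)"]
    by (simp only: case_prod_unfold)
  also have "(\<Sum>(j, l)\<in>{..<n} \<times> {..<?Q}.
      of_nat (u $ (j * ?Q + l)) * (\<alpha> ^ (l + 1) * H $$ (i, j))) = (H *\<^sub>v word_of \<alpha> n u) $ i"
    using H i unfolding sum.cartesian_product[symmetric]
    by (simp add: scalar_prod_def lessThan_atLeast0 word_of_def sum_distrib_left mult_ac)
  finally show ?thesis .
qed

text \<open>
  Congruence modulo \<open>p\<close> is equality in the field, which for the rows \<open>(i, s)\<close> with fixed \<open>i\<close> is
  equality of all coordinates of the \<open>i\<close>th entries of the two syndromes.
\<close>

lemma same_fibre_iff_diff_in_code:
  fixes \<alpha> :: "'f::{finite,field}"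
  assumes p: "prime p" "CARD('f) = p ^ r"
    and basis: "prime_basis r b" and par: "parity_check_matrix n k C H"
    and D: "D \<in> carrier_mat ((n - k) * r) (n * (CARD('f) - 1))"
    and De: "map_mat of_int D = H_plus_e \<alpha> r b H"
    and u: "u \<in> carrier_vec (n * (CARD('f) - 1))" and v: "v \<in> carrier_vec (n * (CARD('f) - 1))"
  shows "(\<exists>y\<in>carrier_vec ((n - k) * r). \<exists>z\<in>carrier_vec ((n - k) * r).
      H_plus p D *\<^sub>v map_vec int (u @\<^sub>v y) = H_plus p D *\<^sub>v map_vec int (v @\<^sub>v z)) \<longleftrightarrow>
    word_of \<alpha> n u - word_of \<alpha> n v \<in> C"
proof -
  let ?m = "n - k"
  have H: "H \<in> carrier_mat ?m n" using par by (simp add: parity_check_matrix_def)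
  let ?d = "\<lambda>w. D *\<^sub>v map_vec int w" and ?h = "\<lambda>w. H *\<^sub>v word_of \<alpha> n w"
  have "(\<forall>t<?m * r. int p dvd ?d u $ t - ?d v $ t) \<longleftrightarrow>
      (\<forall>t<?m * r. (of_int (?d u $ t) :: 'f) = of_int (?d v $ t))"
    unfolding of_int_eq_0_iff_finite_field[OF p, symmetric] by simp
  also have "\<dots> \<longleftrightarrow> (\<forall>i<?m. \<forall>s<r. (of_int (?d u $ (i * r + s)) :: 'f) = of_int (?d v $ (i * r + s)))"
  proof (intro iffI allI impI)
    fix t assume *: "\<forall>i<?m. \<forall>s<r. (of_int (?d u $ (i * r + s)) :: 'f) = of_int (?d v $ (i * r + s))"
      and t: "t < ?m * r"
    have "t div r < ?m" using t by (rule less_mult_imp_div_less)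
    moreover have "t mod r < r" using t by (cases "r = 0") simp_all
    ultimately have "(of_int (?d u $ (t div r * r + t mod r)) :: 'f) =
        of_int (?d v $ (t div r * r + t mod r))"
      using * by blast
    then show "(of_int (?d u $ t) :: 'f) = of_int (?d v $ t)" by (simp only: div_mult_mod_eq)
  qed (simp add: block_index_less)
  also have "\<dots> \<longleftrightarrow> (\<forall>i<?m. \<forall>s<r. coord r b s (?h u $ i) = coord r b s (?h v $ i))"
    using of_int_lift_mult[OF basis H D De u] of_int_lift_mult[OF basis H D De v] by simp
  also have "\<dots> \<longleftrightarrow> (\<forall>i<?m. ?h u $ i = ?h v $ i)"
    using coord_eq_iff[OF basis] by blast
  also have "\<dots> \<longleftrightarrow> ?h u - ?h v = 0\<^sub>v ?m"
    using H by (simp add: vec_eq_iff del: index_mult_mat_vec)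
  also have "\<dots> \<longleftrightarrow> H *\<^sub>v (word_of \<alpha> n u - word_of \<alpha> n v) = 0\<^sub>v ?m"
    by (simp only: mult_minus_distrib_mat_vec[OF H word_of_carrier word_of_carrier])
  also have "\<dots> \<longleftrightarrow> word_of \<alpha> n u - word_of \<alpha> n v \<in> C"
    using par by (simp add: parity_check_matrix_def)
  finally show ?thesis unfolding H_plus_fibre_iff[OF D u v] .
qed

section \<open>The code ideal as a specialised toric ideal\<close>

theorem proposition3p5:
  fixes p r n k :: nat
    and C :: "'f::{finite,field} vec set"
    and H :: "'f mat"
    and \<alpha> :: 'f
    and b :: "nat \<Rightarrow> 'f"
    and D :: "int mat"
  assumes "prime p"
    and "CARD('f) = p ^ r"
    and "linear_code n k C"
    and "parity_check_matrix n k C H"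
    and "primitive_element \<alpha>"
    and "prime_basis r b"
    and "D \<in> carrier_mat ((n - k) * r) (n * (CARD('f) - 1))"
    and "map_mat of_int D = H_plus_e \<alpha> r b H"
  shows "(code_ideal \<alpha> n C :: 'k::field mpoly set) =
    {set_y_one (n * (CARD('f) - 1)) f | f. f \<in> toric_ideal (H_plus p D)}"
proof -
  let ?N = "n * (CARD('f) - 1)" and ?M = "(n - k) * r"
  let ?A = "H_plus p D"
  note fibre = same_fibre_iff_diff_in_code[OF assms(1,2,6,4,7,8)]
  have dim: "dim_col ?A = ?N + ?M" using assms(7) by (simp add: H_plus_def)
  define T :: "'k mpoly set" where "T = {monomial u - monomial v | u v.
      u \<in> carrier_vec (?N + ?M) \<and> v \<in> carrier_vec (?N + ?M) \<and>
      ?A *\<^sub>v map_vec int u = ?A *\<^sub>v map_vec int v}"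
  define G :: "'k mpoly set" where "G = {monomial u - monomial v | u v.
      u \<in> carrier_vec ?N \<and> v \<in> carrier_vec ?N \<and> word_of \<alpha> n u - word_of \<alpha> n v \<in> C}"
  interpret y: ring_hom_ring "mpoly_ring (?N + ?M)" "mpoly_ring ?N" "set_y_one ?N :: 'k mpoly \<Rightarrow> _"
    by (rule ring_hom_set_y_one)
  have eval: "set_y_one ?N (monomial (u @\<^sub>v y) - monomial (v @\<^sub>v z)) = monomial u - monomial v"
    if "u \<in> carrier_vec ?N" "v \<in> carrier_vec ?N" for u v y z
    by (simp only: set_y_one_minus set_y_one_monomial_append[OF that(1)]
        set_y_one_monomial_append[OF that(2)])
  have "set_y_one ?N ` T = (G :: 'k mpoly set)"
  proof (intro equalityI subsetI)
    fix g :: "'k mpoly" assume "g \<in> set_y_one ?N ` T"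
    then obtain u' v' where g: "g = set_y_one ?N (monomial u' - monomial v')"
      and u': "u' \<in> carrier_vec (?N + ?M)" and v': "v' \<in> carrier_vec (?N + ?M)"
      and A: "?A *\<^sub>v map_vec int u' = ?A *\<^sub>v map_vec int v'"
      unfolding T_def by blast
    define u y v z where "u = vec_first u' ?N" and "y = vec_last u' ?M"
      and "v = vec_first v' ?N" and "z = vec_last v' ?M"
    have uv: "u \<in> carrier_vec ?N" "v \<in> carrier_vec ?N"
      and yz: "y \<in> carrier_vec ?M" "z \<in> carrier_vec ?M"
      by (simp_all only: u_def v_def y_def z_def vec_first_carrier vec_last_carrier)
    have app: "u' = u @\<^sub>v y" "v' = v @\<^sub>v z"
      using u' v' unfolding u_def v_def y_def z_def by (simp_all only: vec_first_last_append)
    have "word_of \<alpha> n u - word_of \<alpha> n v \<in> C"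
      using fibre[OF uv] yz A unfolding app by blast
    then show "g \<in> G" unfolding G_def g app eval[OF uv] using uv by blast
  next
    fix g :: "'k mpoly" assume "g \<in> G"
    then obtain u v where g: "g = monomial u - monomial v"
      and uv: "u \<in> carrier_vec ?N" "v \<in> carrier_vec ?N" and C: "word_of \<alpha> n u - word_of \<alpha> n v \<in> C"
      unfolding G_def by blast
    from C obtain y z where yz: "y \<in> carrier_vec ?M" "z \<in> carrier_vec ?M"
      and A: "?A *\<^sub>v map_vec int (u @\<^sub>v y) = ?A *\<^sub>v map_vec int (v @\<^sub>v z)"
      using fibre[OF uv] by blast
    have "(monomial (u @\<^sub>v y) - monomial (v @\<^sub>v z) :: 'k mpoly) \<in> T"
      unfolding T_def using A append_carrier_vec[OF uv(1) yz(1)] append_carrier_vec[OF uv(2) yz(2)]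
      by blast
    then show "g \<in> set_y_one ?N ` T" unfolding g eval[OF uv, of y z, symmetric] by (rule imageI)
  qed
  moreover have "T \<subseteq> carrier (mpoly_ring (?N + ?M))"
    unfolding T_def by (auto intro!: minus_closed_mp monomial_closed)
  ultimately have image: "set_y_one ?N ` toric_ideal ?A = Idl\<^bsub>mpoly_ring ?N\<^esub> (G :: 'k mpoly set)"
    unfolding toric_ideal_def dim T_def[symmetric] using y.surj_image_Idl[OF set_y_one_surj] by metis
  have "0\<^sub>v n \<in> C" using assms(4) by (auto simp: parity_check_matrix_def)
  then have "code_ideal \<alpha> n C = Idl\<^bsub>mpoly_ring ?N\<^esub> (G :: 'k mpoly set)"
    unfolding G_def by (rule code_ideal_eq_congruence_ideal[OF assms(5)])
  then show ?thesis using image by (simp only: Setcompr_eq_image Collect_mem_eq)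
qed

end
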